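(* Let $(\Omega,\mathsf{F},\mathbb{P})$ and $(E,\mathsf{E},\mu)$ be probability spaces, with $(E,\mathsf{E},\mu)$ complete and separable, and let $\mathcal{H}$ be a separable full Hilbert-Hadamard space. Let $(\xi_i)_{i\ge 1}$ be an i.i.d. sequence of random variables $\xi_i:\Omega\to E$ with distribution $\mu$. Let $f:E\times\mathcal{H}\to(-\infty,+\infty]$ be a proper normal convex integrand which is $L^2$-Lipschitz, and suppose that there exists $u_0\in L^2(E,\mathcal{H},\mu)$ such that $f(\cdot,u_0(\cdot))\in L^1(E,\mathbb{R},\mu)$. Let $S_t(x)$ denote the gradient flow semigroup associated with the function $x\mapsto\int f(e,x)\,d\mu(e)$. Then there exists a set $\Omega'\subseteq\Omega$ with $\mathbb{P}(\Omega')=1$ such that for every $\omega\in\Omega'$, every $t\ge 0$ and every $x\in\mathcal{H}$: \[ S_t(x)=\lim_{n\to\infty}\left(\mathrm{prox}_{\frac{t}{n^2}f(\xi_n(\omega),\cdot)}\circ\dots\circ\mathrm{prox}_{\frac{t}{n^2}f(\xi_1(\omega),\cdot)}\right)^{(n)}(x). \] In particular, for every $t\ge 0$ and every $x\in\mathcal{H}$, the limit $S_t(x)=\lim_{n\to\infty}\left(\mathrm{prox}_{\frac{t}{n^2}f(\xi_n,\cdot)}\circ\dots\circ\mathrm{prox}_{\frac{t}{n^2}f(\xi_1,\cdot)}\right)^{(n)}(x)$ holds $\mathbb{P}$-almost surely.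
   Context: A geodesic in a metric space $(\mathcal{H},d)$ is an isometric embedding $\gamma:[0,l]\to\mathcal{H}$; it issues from $\gamma(0)$ and joins $\gamma(0)$ and $\gamma(l)$. A Hadamard space is a complete metric space in which any two points are joined by a geodesic and such that $d^2(\gamma(tl),x)\le(1-t)d^2(\gamma(0),x)+td^2(\gamma(l),x)-t(1-t)d^2(\gamma(0),\gamma(l))$ for all $x\in\mathcal{H}$, $t\in[0,1]$ and all geodesics $\gamma:[0,l]\to\mathcal{H}$. Geodesics between two points are then unique. A function $h:\mathcal{H}\to(-\infty,+\infty]$ is convex if it is convex along geodesics. Tangent cones: for nonconstant geodesics $\gamma,\eta$ issuing from $x$, the Alexandrov angle is $\angle_x(\gamma,\eta)=\lim_{s,t\to0^+}\bar\angle_x(\gamma(s),\eta(t))$, where $\bar\angle_x(y,z)$ is the angle at $\bar x$ of the Euclidean comparison triangle of $x,y,z$. It is a pseudometric; let $\Sigma'_x\mathcal{H}$ be the resulting metric space of equivalence classes (angle $0$) of geodesics and $\Sigma_x\mathcal{H}$ its completion. The tangent cone $T_x\mathcal{H}$ is the Euclidean cone over $\Sigma_x\mathcal{H}$, i.e. the set of classes $t\gamma$ of pairs $(\gamma,t)\in\Sigma_x\mathcal{H}\times[0,\infty)$ (all pairs with $t=0$ being identified) with metric $d_x(t\gamma,s\eta)=\sqrt{t^2+s^2-2ts\cos\angle_x(\gamma,\eta)}$. A full Hilbert-Hadamard space is a Hadamard space such that every tangent cone $T_x\mathcal{H}$ is isometric to a Hilbert space. A probability space $(E,\mathsf{E},\mu)$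 is separable if $\mathsf{E}$ with the (pseudo)metric $d_\mu(A,B)=\mu(A\triangle B)$ is separable. $L^2(E,\mathcal{H},\mu)$ is the space of ($\mu$-a.e. classes of) measurable $u:E\to\mathcal{H}$ with $\int d^2(u,z)\,d\mu<\infty$ for some/any $z\in\mathcal{H}$. $f:E\times\mathcal{H}\to(-\infty,+\infty]$ is a normal integrand if $f(e,\cdot)$ is lower-semicontinuous for all $e\in E$ and the set-valued map $e\mapsto\{(x,\alpha)\in\mathcal{H}\times\mathbb{R}\mid f(e,x)\le\alpha\}$ is measurable (i.e. for every closed set $C$, the set of $e$ whose image meets $C$ is in $\mathsf{E}$); for complete $(E,\mathsf{E},\mu)$ the measurability can equivalently be replaced by $\mathsf{E}\otimes\mathsf{B}(\mathcal{H})$-measurability of $f$. It is a normal convex integrand if moreover every $f(e,\cdot)$ is convex, and proper if every $f(e,\cdot)$ is proper. $f$ is $L^2$-Lipschitz if there is $L\in L^2(E,(0,\infty),\mu)$ such that $|f(e,x)-f(e,y)|\le L(e)d(x,y)$ for all $x,y\in\mathcal{H}$ and $e\in E$. For $h:\mathcal{H}\to(-\infty,+\infty]$ proper, convex and lower-semicontinuous and $\lambda>0$, $\mathrm{prox}_{\lambda h}(x)=\mathrm{argmin}_{y\in\mathcal{H}}\{h(y)+\frac1{2\lambda}d^2(x,y)\}$ (a single point), and $\mathrm{prox}_{0\cdot h}$ is the identity. The gradient flow semigroup associated with $h$ is $S_t(x)=\lim_{k\to\infty}(\mathrm{prox}_{\frac tk h})^{(k)}(x)$ for $t>0$ and $S_0(x)=x$,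 for $x$ in the closure of the domain of $h$. $Q^{(n)}$ denotes the $n$-fold iterate of a map $Q$. *)

theory Defs
  imports "HOL-Probability.Probability"
begin

section \<open>Geodesics and Hadamard spaces\<close>

definition geodesic :: "real \<Rightarrow> (real \<Rightarrow> 'h::metric_space) \<Rightarrow> bool" where
  "geodesic l \<gamma> \<longleftrightarrow> 0 \<le> l \<and> (\<forall>s\<in>{0..l}. \<forall>t\<in>{0..l}. dist (\<gamma> s) (\<gamma> t) = \<bar>s - t\<bar>)"

definition hadamard_space :: "'h::metric_space itself \<Rightarrow> bool" where
  "hadamard_space _ \<longleftrightarrow>
     uniform_space_class.complete (UNIV :: 'h set) \<and>
     (\<forall>x y :: 'h. \<exists>l \<gamma>. geodesic l \<gamma> \<and> \<gamma> 0 = x \<and> \<gamma> l = y) \<and>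
     (\<forall>l. \<forall>\<gamma> :: real \<Rightarrow> 'h. geodesic l \<gamma> \<longrightarrow> (\<forall>x. \<forall>t\<in>{0..1}.
        (dist (\<gamma> (t * l)) x)\<^sup>2 \<le>
          (1 - t) * (dist (\<gamma> 0) x)\<^sup>2 + t * (dist (\<gamma> l) x)\<^sup>2
            - t * (1 - t) * (dist (\<gamma> 0) (\<gamma> l))\<^sup>2))"

definition geodesically_convex :: "('h::metric_space \<Rightarrow> ereal) \<Rightarrow> bool" where
  "geodesically_convex h \<longleftrightarrow>
     (\<forall>l \<gamma>. geodesic l \<gamma> \<longrightarrow> (\<forall>t\<in>{0..1}.
        h (\<gamma> (t * l)) \<le> ereal (1 - t) * h (\<gamma> 0) + ereal t * h (\<gamma> l)))"

definition lower_semicontinuous :: "('h::topological_space \<Rightarrow> ereal) \<Rightarrow> bool" where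
  "lower_semicontinuous h \<longleftrightarrow> (\<forall>x. h x \<le> Liminf (at x) h)"

definition proper_fun :: "('h \<Rightarrow> ereal) \<Rightarrow> bool" where
  "proper_fun h \<longleftrightarrow> (\<forall>x. h x \<noteq> -\<infinity>) \<and> (\<exists>x. h x \<noteq> \<infinity>)"


section \<open>Tangent cones\<close>

text \<open>The angle at the vertex corresponding to \<open>x\<close> of a Euclidean triangle with the side lengths
  of \<open>x, y, z\<close>, by the law of cosines; see \<open>comparison_angle_euclidean\<close> below.\<close>

definition comparison_angle :: "'h::metric_space \<Rightarrow> 'h \<Rightarrow> 'h \<Rightarrow> real" where
  "comparison_angle x y z =
     arccos (((dist x y)\<^sup>2 + (dist x z)\<^sup>2 - (dist y z)\<^sup>2) / (2 * dist x y * dist x z))"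

lemma comparison_angle_euclidean:
  fixes p q r :: "real ^ 2"
  assumes "dist p q = dist x y" "dist p r = dist x z" "dist q r = dist y z"
  shows "comparison_angle x y z = arccos (inner (q - p) (r - p) / (norm (q - p) * norm (r - p)))"
proof -
  have "(dist q r)\<^sup>2 = (dist p q)\<^sup>2 + (dist p r)\<^sup>2 - 2 * inner (q - p) (r - p)"
    by (simp add: dist_norm power2_norm_eq_inner inner_diff_left inner_diff_right inner_commute)
  then have "((dist p q)\<^sup>2 + (dist p r)\<^sup>2 - (dist q r)\<^sup>2) / (2 * dist p q * dist p r) =
      inner (q - p) (r - p) / (norm (q - p) * norm (r - p))"
    by (simp add: dist_norm norm_minus_commute)
  then show ?thesis
    using assms by (simp add: comparison_angle_def)
qed

text \<open>A nonconstant geodesic is represented by its length together with its parametrisation, of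
  which only the values on \<open>[0, l]\<close> matter.\<close>

definition geodesics_from :: "'h::metric_space \<Rightarrow> (real \<times> (real \<Rightarrow> 'h)) set" where
  "geodesics_from x = {(l, \<gamma>). 0 < l \<and> geodesic l \<gamma> \<and> \<gamma> 0 = x}"

definition alexandrov_angle ::
    "'h::metric_space \<Rightarrow> real \<times> (real \<Rightarrow> 'h) \<Rightarrow> real \<times> (real \<Rightarrow> 'h) \<Rightarrow> real" where
  "alexandrov_angle x g k =
     Lim (at_right 0 \<times>\<^sub>F at_right 0) (\<lambda>(s, t). comparison_angle x (snd g s) (snd k t))"

definition zero_dist_rel :: "'a set \<Rightarrow> ('a \<Rightarrow> 'a \<Rightarrow> real) \<Rightarrow> ('a \<times> 'a) set" where
  "zero_dist_rel X d = {(a, b). a \<in> X \<and> b \<in> X \<and> d a b = 0}"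

definition class_dist :: "('a \<Rightarrow> 'a \<Rightarrow> real) \<Rightarrow> 'a set \<Rightarrow> 'a set \<Rightarrow> real" where
  "class_dist d A B = d (SOME a. a \<in> A) (SOME b. b \<in> B)"

definition cauchy_seqs :: "'a set \<Rightarrow> ('a \<Rightarrow> 'a \<Rightarrow> real) \<Rightarrow> (nat \<Rightarrow> 'a) set" where
  "cauchy_seqs X d =
     {\<sigma>. range \<sigma> \<subseteq> X \<and> (\<forall>\<epsilon>>0. \<exists>N. \<forall>m\<ge>N. \<forall>n\<ge>N. d (\<sigma> m) (\<sigma> n) < \<epsilon>)}"

definition seq_dist :: "('a \<Rightarrow> 'a \<Rightarrow> real) \<Rightarrow> (nat \<Rightarrow> 'a) \<Rightarrow> (nat \<Rightarrow> 'a) \<Rightarrow> real" where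
  "seq_dist d \<sigma> \<tau> = lim (\<lambda>n. d (\<sigma> n) (\<tau> n))"

definition metric_completion :: "'a set \<Rightarrow> ('a \<Rightarrow> 'a \<Rightarrow> real) \<Rightarrow> (nat \<Rightarrow> 'a) set set" where
  "metric_completion X d = cauchy_seqs X d // zero_dist_rel (cauchy_seqs X d) (seq_dist d)"

definition completion_dist ::
    "('a \<Rightarrow> 'a \<Rightarrow> real) \<Rightarrow> (nat \<Rightarrow> 'a) set \<Rightarrow> (nat \<Rightarrow> 'a) set \<Rightarrow> real" where
  "completion_dist d = class_dist (seq_dist d)"

text \<open>The Euclidean cone over \<open>S\<close>. The class \<open>S \<times> {0}\<close> of all pairs with \<open>t = 0\<close> is the apex; it is
  inserted explicitly so that, as usual, the cone over the empty set is a single point (the tangent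
  cone of a one-point space). In that case the apex is the empty set of pairs, which is why
  \<open>cone_dist\<close> treats the empty set separately.\<close>

definition cone_rel :: "'s set \<Rightarrow> (('s \<times> real) \<times> ('s \<times> real)) set" where
  "cone_rel S = {((a, t), (b, s)).
     a \<in> S \<and> b \<in> S \<and> 0 \<le> t \<and> 0 \<le> s \<and> (t = 0 \<and> s = 0 \<or> t = s \<and> a = b)}"

definition euclidean_cone :: "'s set \<Rightarrow> ('s \<times> real) set set" where
  "euclidean_cone S = insert (S \<times> {0}) ((S \<times> {0..}) // cone_rel S)"

definition cone_dist :: "('s \<Rightarrow> 's \<Rightarrow> real) \<Rightarrow> ('s \<times> real) set \<Rightarrow> ('s \<times> real) set \<Rightarrow> real" where
  "cone_dist \<alpha> P Q =
     (if P = {} \<or> Q = {} then 0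
      else class_dist (\<lambda>(a, t) (b, s). sqrt (t\<^sup>2 + s\<^sup>2 - 2 * t * s * cos (\<alpha> a b))) P Q)"

definition pre_directions :: "'h::metric_space \<Rightarrow> (real \<times> (real \<Rightarrow> 'h)) set set" where
  "pre_directions x = geodesics_from x // zero_dist_rel (geodesics_from x) (alexandrov_angle x)"

definition directions :: "'h::metric_space \<Rightarrow> (nat \<Rightarrow> (real \<times> (real \<Rightarrow> 'h)) set) set set" where
  "directions x = metric_completion (pre_directions x) (class_dist (alexandrov_angle x))"

definition directions_dist ::
    "'h::metric_space \<Rightarrow> (nat \<Rightarrow> (real \<times> (real \<Rightarrow> 'h)) set) set
      \<Rightarrow> (nat \<Rightarrow> (real \<times> (real \<Rightarrow> 'h)) set) set \<Rightarrow> real" where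
  "directions_dist x = completion_dist (class_dist (alexandrov_angle x))"

definition tangent_cone ::
    "'h::metric_space \<Rightarrow> ((nat \<Rightarrow> (real \<times> (real \<Rightarrow> 'h)) set) set \<times> real) set set" where
  "tangent_cone x = euclidean_cone (directions x)"

definition tangent_cone_dist ::
    "'h::metric_space \<Rightarrow> ((nat \<Rightarrow> (real \<times> (real \<Rightarrow> 'h)) set) set \<times> real) set
      \<Rightarrow> ((nat \<Rightarrow> (real \<times> (real \<Rightarrow> 'h)) set) set \<times> real) set \<Rightarrow> real" where
  "tangent_cone_dist x = cone_dist (directions_dist x)"


section \<open>Hilbert spaces with an explicit carrier\<close>

text \<open>``There is a Hilbert space such that ...'' cannot quantify over instances of a type class,
  so real Hilbert spaces are described on a carrier set \<open>V\<close>.\<close>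

locale hilbert_on =
  fixes V :: "'v set" and zero :: 'v and add :: "'v \<Rightarrow> 'v \<Rightarrow> 'v"
    and smult :: "real \<Rightarrow> 'v \<Rightarrow> 'v" and ip :: "'v \<Rightarrow> 'v \<Rightarrow> real"
  assumes zero_closed: "zero \<in> V"
    and add_closed: "u \<in> V \<Longrightarrow> v \<in> V \<Longrightarrow> add u v \<in> V"
    and smult_closed: "u \<in> V \<Longrightarrow> smult a u \<in> V"
    and add_assoc: "u \<in> V \<Longrightarrow> v \<in> V \<Longrightarrow> w \<in> V \<Longrightarrow> add (add u v) w = add u (add v w)"
    and add_comm: "u \<in> V \<Longrightarrow> v \<in> V \<Longrightarrow> add u v = add v u"
    and add_zero: "u \<in> V \<Longrightarrow> add zero u = u"
    and add_inverse: "u \<in> V \<Longrightarrow> add u (smult (-1) u) = zero"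
    and smult_add: "u \<in> V \<Longrightarrow> v \<in> V \<Longrightarrow> smult a (add u v) = add (smult a u) (smult a v)"
    and add_smult: "u \<in> V \<Longrightarrow> smult (a + b) u = add (smult a u) (smult b u)"
    and smult_smult: "u \<in> V \<Longrightarrow> smult a (smult b u) = smult (a * b) u"
    and smult_one: "u \<in> V \<Longrightarrow> smult 1 u = u"
    and ip_comm: "u \<in> V \<Longrightarrow> v \<in> V \<Longrightarrow> ip u v = ip v u"
    and ip_add: "u \<in> V \<Longrightarrow> v \<in> V \<Longrightarrow> w \<in> V \<Longrightarrow> ip (add u v) w = ip u w + ip v w"
    and ip_smult: "u \<in> V \<Longrightarrow> v \<in> V \<Longrightarrow> ip (smult a u) v = a * ip u v"
    and ip_nonneg: "u \<in> V \<Longrightarrow> 0 \<le> ip u u"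
    and ip_definite: "u \<in> V \<Longrightarrow> ip u u = 0 \<Longrightarrow> u = zero"
    and complete: "\<sigma> \<in> cauchy_seqs V (\<lambda>u v. sqrt (ip (add u (smult (-1) v)) (add u (smult (-1) v))))
      \<Longrightarrow> \<exists>v\<in>V. (\<lambda>n. sqrt (ip (add (\<sigma> n) (smult (-1) v)) (add (\<sigma> n) (smult (-1) v))))
                  \<longlonglongrightarrow> 0"

lemma hilbert_on_UNIV:
  "hilbert_on (UNIV :: 'a::{real_inner, complete_space} set) 0 (+) (*\<^sub>R) inner"
proof
  fix \<sigma> :: "nat \<Rightarrow> 'a"
  assume "\<sigma> \<in> cauchy_seqs UNIV
    (\<lambda>u v. sqrt (inner (u + (-1) *\<^sub>R v) (u + (-1) *\<^sub>R v)))"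
  then have "Cauchy \<sigma>"
    unfolding cauchy_seqs_def Cauchy_def
    by (simp add: dist_norm norm_eq_sqrt_inner)
  then obtain v where "\<sigma> \<longlonglongrightarrow> v"
    unfolding Cauchy_convergent_iff convergent_def by blast
  then have "(\<lambda>n. dist (\<sigma> n) v) \<longlonglongrightarrow> 0"
    by (rule tendsto_dist_iff[THEN iffD1])
  then show "\<exists>v\<in>UNIV. (\<lambda>n. sqrt (inner (\<sigma> n + (-1) *\<^sub>R v) (\<sigma> n + (-1) *\<^sub>R v)))
      \<longlonglongrightarrow> 0"
    by (auto simp: dist_norm norm_eq_sqrt_inner)
qed (simp_all add: scaleR_add_right scaleR_add_left inner_add_left inner_add_right inner_commute)

text \<open>A Hilbert space isometric to \<open>(X, d)\<close> is in bijection with \<open>X\<close>, so its structure can be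
  transported to a subset of the type of \<open>X\<close>; taking \<open>V\<close> in that type loses no generality.\<close>

definition isometric_to_hilbert :: "'v set \<Rightarrow> ('v \<Rightarrow> 'v \<Rightarrow> real) \<Rightarrow> bool" where
  "isometric_to_hilbert X d \<longleftrightarrow>
     (\<exists>(V :: 'v set) zero add smult ip \<phi>.
        hilbert_on V zero add smult ip \<and> bij_betw \<phi> X V \<and>
        (\<forall>p\<in>X. \<forall>q\<in>X.
           sqrt (ip (add (\<phi> p) (smult (-1) (\<phi> q))) (add (\<phi> p) (smult (-1) (\<phi> q)))) = d p q))"

definition full_hilbert_hadamard_space :: "'h::metric_space itself \<Rightarrow> bool" where
  "full_hilbert_hadamard_space T \<longleftrightarrow>
     hadamard_space T \<and>
     (\<forall>x :: 'h. isometric_to_hilbert (tangent_cone x) (tangent_cone_dist x))"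


section \<open>Measure spaces, integrands and integrals\<close>

definition separable_measure :: "'e measure \<Rightarrow> bool" where
  "separable_measure M \<longleftrightarrow>
     (\<exists>D. countable D \<and> D \<subseteq> sets M \<and>
        (\<forall>A\<in>sets M. \<forall>\<epsilon>>0. \<exists>B\<in>D. measure M (sym_diff A B) < \<epsilon>))"

definition L2_map :: "'e measure \<Rightarrow> ('e \<Rightarrow> 'h::metric_space) \<Rightarrow> bool" where
  "L2_map M u \<longleftrightarrow> u \<in> borel_measurable M \<and> (\<exists>z. integrable M (\<lambda>e. (dist (u e) z)\<^sup>2))"

definition L1_ereal :: "'e measure \<Rightarrow> ('e \<Rightarrow> ereal) \<Rightarrow> bool" where
  "L1_ereal M \<phi> \<longleftrightarrow> (\<exists>g :: 'e \<Rightarrow> real. integrable M g \<and> (AE e in M. \<phi> e = ereal (g e)))"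

text \<open>The integral of an extended-real function; since \<open>\<infinity> - \<infinity> = \<infinity>\<close> in \<open>ereal\<close>, its value is \<open>\<infinity>\<close>
  whenever the integral of the positive part is infinite.\<close>

definition ereal_integral :: "'e measure \<Rightarrow> ('e \<Rightarrow> ereal) \<Rightarrow> ereal" where
  "ereal_integral M \<phi> =
     enn2ereal (\<integral>\<^sup>+ e. e2ennreal (\<phi> e) \<partial>M) - enn2ereal (\<integral>\<^sup>+ e. e2ennreal (- \<phi> e) \<partial>M)"

definition normal_integrand :: "'e measure \<Rightarrow> ('e \<Rightarrow> 'h::metric_space \<Rightarrow> ereal) \<Rightarrow> bool" where
  "normal_integrand M f \<longleftrightarrow>
     (\<forall>e\<in>space M. (\<forall>x. f e x \<noteq> -\<infinity>) \<and> lower_semicontinuous (f e)) \<and>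
     (\<forall>C :: ('h \<times> real) set. closed C \<longrightarrow>
        {e \<in> space M. \<exists>(x, \<alpha>)\<in>C. f e x \<le> ereal \<alpha>} \<in> sets M)"

definition normal_convex_integrand :: "'e measure \<Rightarrow> ('e \<Rightarrow> 'h::metric_space \<Rightarrow> ereal) \<Rightarrow> bool" where
  "normal_convex_integrand M f \<longleftrightarrow>
     normal_integrand M f \<and> (\<forall>e\<in>space M. geodesically_convex (f e))"

definition proper_integrand :: "'e measure \<Rightarrow> ('e \<Rightarrow> 'h \<Rightarrow> ereal) \<Rightarrow> bool" where
  "proper_integrand M f \<longleftrightarrow> (\<forall>e\<in>space M. proper_fun (f e))"

text \<open>For a proper \<open>f\<close> this forces every \<open>f e\<close> to be finite, since \<open>\<bar>\<infinity> - \<infinity>\<bar> = \<infinity>\<close> in \<open>ereal\<close>.\<close>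

definition L2_Lipschitz :: "'e measure \<Rightarrow> ('e \<Rightarrow> 'h::metric_space \<Rightarrow> ereal) \<Rightarrow> bool" where
  "L2_Lipschitz M f \<longleftrightarrow>
     (\<exists>L :: 'e \<Rightarrow> real. L2_map M L \<and> (\<forall>e\<in>space M. 0 < L e) \<and>
        (\<forall>e\<in>space M. \<forall>x y. \<bar>f e x - f e y\<bar> \<le> ereal (L e * dist x y)))"


section \<open>Proximal maps and gradient flow\<close>

definition prox :: "real \<Rightarrow> ('h::metric_space \<Rightarrow> ereal) \<Rightarrow> 'h \<Rightarrow> 'h" where
  "prox c h x =
     (if c = 0 then x else arg_min (\<lambda>y. h y + ereal ((dist x y)\<^sup>2 / (2 * c))) (\<lambda>_. True))"

definition gradient_flow :: "('h::metric_space \<Rightarrow> ereal) \<Rightarrow> real \<Rightarrow> 'h \<Rightarrow> 'h" where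
  "gradient_flow h t x = (if t = 0 then x else lim (\<lambda>k. (prox (t / real k) h ^^ k) x))"

definition prox_product :: "(nat \<Rightarrow> 'h::metric_space \<Rightarrow> ereal) \<Rightarrow> real \<Rightarrow> nat \<Rightarrow> 'h \<Rightarrow> 'h" where
  \<comment> \<open>\<open>prox c (g n) \<circ> \<dots> \<circ> prox c (g 1)\<close>\<close>
  "prox_product g c n = fold (\<lambda>i. prox c (g i)) [1..<Suc n]"

end

(* The minimizer p of 2c g + d(x,.)^2 satisfies the variational inequality
     2c g(p) + d(x,p)^2 + d(p,z)^2 <= 2c g(z) + d(x,z)^2   for all z.
   For Lipschitz g_1, ..., g_n with mean G, a cycle of n proximal steps of size delta/n satisfies, up to
   O(delta^2), the same inequality with G evaluated at the starting point. Adding it to the inequality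
   for prox_(delta G) cancels all function values, so t/delta iterations of the two maps stay within
   O(sqrt(delta)), uniformly in n. With constant g_i the same estimate compares the proximal iterates of
   one function for different step sizes. Hence it is enough to show that, almost surely, the resolvents
   of the empirical means converge to those of the integral.

   This is a law of large numbers for strongly convex stochastic minimization, obtained from stability:
   leaving out the i-th sample moves the empirical proximal point by at most c L_i / n, and the point
   built from the other samples is independent of the i-th. This gives E d^2 = O(1/n), hence almost
   sure convergence along n = k^2; the gaps are filled by the stability of proximal points under
   Lipschitz perturbations, together with the law of large numbers for the Lipschitz constants. *)

theory Submission
  imports Defs
begin

section \<open>Proximal maps of Lipschitz convex functions\<close>

text \<open>The sign of \<open>L\<close> is a separate condition because in a one-point space the
  Lipschitz bound does not force it.\<close>

definition convex_lipschitz :: "real \<Rightarrow> ('h::metric_space \<Rightarrow> real) \<Rightarrow> bool" where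
  "convex_lipschitz L g \<longleftrightarrow> 0 \<le> L \<and> geodesically_convex (\<lambda>x. ereal (g x)) \<and>
     (\<forall>x y. \<bar>g x - g y\<bar> \<le> L * dist x y)"

abbreviation rprox :: "real \<Rightarrow> ('h::metric_space \<Rightarrow> real) \<Rightarrow> 'h \<Rightarrow> 'h" where
  "rprox c g \<equiv> prox c (\<lambda>y. ereal (g y))"

lemma geodesically_convex_real_iff:
  "geodesically_convex (\<lambda>x. ereal (g x)) \<longleftrightarrow>
    (\<forall>l \<gamma>. geodesic l \<gamma> \<longrightarrow> (\<forall>t\<in>{0..1}. g (\<gamma> (t * l)) \<le> (1 - t) * g (\<gamma> 0) + t * g (\<gamma> l)))"
  by (simp add: geodesically_convex_def)

lemma convex_lipschitzD:
  assumes "convex_lipschitz L g"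
  shows "0 \<le> L" "\<bar>g x - g y\<bar> \<le> L * dist x y" "g x - g y \<le> L * dist x y"
  using assms by (auto simp: convex_lipschitz_def abs_le_iff)

lemma convex_lipschitz_sum:
  fixes g :: "'i \<Rightarrow> 'h::metric_space \<Rightarrow> real"
  assumes "finite A" "0 \<le> a" "\<And>i. i \<in> A \<Longrightarrow> convex_lipschitz (L i) (g i)"
  shows "convex_lipschitz (a * (\<Sum>i\<in>A. L i)) (\<lambda>x. a * (\<Sum>i\<in>A. g i x))"
  unfolding convex_lipschitz_def geodesically_convex_real_iff
proof (intro conjI allI impI ballI)
  show "0 \<le> a * (\<Sum>i\<in>A. L i)"
    using assms convex_lipschitzD(1) by (intro mult_nonneg_nonneg sum_nonneg) auto
next
  fix l :: real and \<gamma> :: "real \<Rightarrow> 'h" and t :: real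
  assume \<gamma>: "geodesic l \<gamma>" and t: "t \<in> {0..1}"
  have "(\<Sum>i\<in>A. g i (\<gamma> (t * l))) \<le> (\<Sum>i\<in>A. (1 - t) * g i (\<gamma> 0) + t * g i (\<gamma> l))"
    using assms(3) \<gamma> t by (intro sum_mono) (auto simp: convex_lipschitz_def geodesically_convex_real_iff)
  then have "a * (\<Sum>i\<in>A. g i (\<gamma> (t * l))) \<le> a * (\<Sum>i\<in>A. (1 - t) * g i (\<gamma> 0) + t * g i (\<gamma> l))"
    using assms(2) by (rule mult_left_mono)
  then show "a * (\<Sum>i\<in>A. g i (\<gamma> (t * l)))
      \<le> (1 - t) * (a * (\<Sum>i\<in>A. g i (\<gamma> 0))) + t * (a * (\<Sum>i\<in>A. g i (\<gamma> l)))"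
    by (simp add: sum.distrib sum_subtractf sum_distrib_left[symmetric] algebra_simps)
next
  fix x y
  have "\<bar>a * (\<Sum>i\<in>A. g i x) - a * (\<Sum>i\<in>A. g i y)\<bar> = a * \<bar>\<Sum>i\<in>A. g i x - g i y\<bar>"
    using assms(2) by (simp add: sum_subtractf right_diff_distrib[symmetric] abs_mult)
  also have "\<dots> \<le> a * (\<Sum>i\<in>A. \<bar>g i x - g i y\<bar>)"
    using assms(2) by (intro mult_left_mono sum_abs)
  also have "\<dots> \<le> a * (\<Sum>i\<in>A. L i * dist x y)"
    using assms by (intro mult_left_mono sum_mono convex_lipschitzD(2)) auto
  finally show "\<bar>a * (\<Sum>i\<in>A. g i x) - a * (\<Sum>i\<in>A. g i y)\<bar> \<le> a * (\<Sum>i\<in>A. L i) * dist x y"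
    by (simp add: sum_distrib_right mult.assoc)
qed

lemma convex_lipschitz_mono:
  "convex_lipschitz L g \<Longrightarrow> L \<le> L' \<Longrightarrow> convex_lipschitz L' g"
  unfolding convex_lipschitz_def by (meson mult_right_mono order_trans zero_le_dist)

context
  assumes hadamard: "hadamard_space TYPE('h::metric_space)"
begin

text \<open>The point is taken on a geodesic from \<open>p\<close> to \<open>z\<close> before
  \<open>g\<close> and \<open>x\<close> are given, so one \<open>w\<close> serves both inequalities.
  Together they make a convex function plus a squared distance strongly convex.\<close>

lemma hadamard_point_between:
  fixes p z :: 'h
  assumes t: "0 \<le> t" "t \<le> 1"
  obtains w where
    "\<And>L g. convex_lipschitz L (g :: 'h \<Rightarrow> real) \<Longrightarrow> g w \<le> (1 - t) * g p + t * g z"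
    "\<And>x. (dist x w)\<^sup>2 \<le> (1 - t) * (dist x p)\<^sup>2 + t * (dist x z)\<^sup>2 - t * (1 - t) * (dist p z)\<^sup>2"
proof -
  obtain l \<gamma> where g: "geodesic l \<gamma>" "\<gamma> 0 = p" "\<gamma> l = z"
    using hadamard unfolding hadamard_space_def by metis
  show thesis
  proof (rule that[of "\<gamma> (t * l)"])
    fix L and g :: "'h \<Rightarrow> real" assume "convex_lipschitz L g"
    then show "g (\<gamma> (t * l)) \<le> (1 - t) * g p + t * g z"
      using g t unfolding convex_lipschitz_def geodesically_convex_real_iff by force
  next
    fix x
    have "(dist (\<gamma> (t * l)) x)\<^sup>2 \<le>
          (1 - t) * (dist (\<gamma> 0) x)\<^sup>2 + t * (dist (\<gamma> l) x)\<^sup>2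
            - t * (1 - t) * (dist (\<gamma> 0) (\<gamma> l))\<^sup>2"
      using hadamard g(1) t unfolding hadamard_space_def by (metis atLeastAtMost_iff)
    then show "(dist x (\<gamma> (t * l)))\<^sup>2 \<le> (1 - t) * (dist x p)\<^sup>2 + t * (dist x z)\<^sup>2 - t * (1 - t) * (dist p z)\<^sup>2"
      using g by (simp add: dist_commute)
  qed
qed

section \<open>Existence of proximal points and the variational inequality\<close>

text \<open>The direct method without compactness: the value at a midpoint lies below the average of
  the values at the ends by a multiple of their squared distance, so a minimizing sequence is
  Cauchy, and completeness supplies its limit.\<close>

lemma prox_minimizer_exists:
  fixes x :: 'h
  assumes c: "0 < c" and g: "convex_lipschitz L g"
  shows "\<exists>p. \<forall>y. g p + (dist x p)\<^sup>2 / (2 * c) \<le> g y + (dist x y)\<^sup>2 / (2 * c)"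
proof -
  define \<phi> where "\<phi> y = g y + (dist x y)\<^sup>2 / (2 * c)" for y
  define m where "m = Inf (range \<phi>)"
  \<comment> \<open>Young's inequality absorbs the linear decrease of \<open>g\<close> into the
    quadratic term.\<close>
  have "g x - c * L\<^sup>2 / 2 \<le> \<phi> y" for y
  proof -
    have "L * dist x y \<le> (dist x y)\<^sup>2 / (2 * c) + c * L\<^sup>2 / 2"
      using sum_squares_bound[of "dist x y" "c * L"] c by (simp add: field_simps power2_eq_square)
    then show ?thesis
      using convex_lipschitzD(3)[OF g, of x y] unfolding \<phi>_def by linarith
  qed
  then have bdd: "bdd_below (range \<phi>)"
    by (intro bdd_belowI2)
  then have m_le: "m \<le> \<phi> y" for y
    unfolding m_def by (intro cInf_lower) auto
  have "\<exists>y. \<phi> y < m + inverse (real (Suc n))" for n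
  proof -
    have "Inf (range \<phi>) < m + inverse (real (Suc n))"
      by (simp add: m_def)
    then show ?thesis
      using cInf_lessD[of "range \<phi>"] by blast
  qed
  then obtain y where y: "\<And>n. \<phi> (y n) < m + inverse (real (Suc n))"
    by metis
  \<comment> \<open>The infimum \<open>m\<close> is compared with the value at the midpoint
    \<open>w\<close> of \<open>u\<close> and \<open>v\<close>, which gains
    \<open>d(u,v)^2 / (8 c)\<close> over the average.\<close>
  have close: "(dist u v)\<^sup>2 \<le> 8 * c * e" if "\<phi> u \<le> m + e" "\<phi> v \<le> m + e" for u v e
  proof -
    obtain w where w: "g w \<le> (1 - 1/2) * g u + 1/2 * g v"
      "(dist x w)\<^sup>2 \<le> (1 - 1/2) * (dist x u)\<^sup>2 + 1/2 * (dist x v)\<^sup>2 - 1/2 * (1 - 1/2) * (dist u v)\<^sup>2"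
      using hadamard_point_between[of "1/2" u v] g by (metis divide_le_eq_1 half_gt_zero_iff less_eq_real_def
          one_le_numeral zero_less_numeral zero_less_one)
    have "(dist x w)\<^sup>2 / (2 * c)
        \<le> ((dist x u)\<^sup>2 / 2 + (dist x v)\<^sup>2 / 2 - (dist u v)\<^sup>2 / 4) / (2 * c)"
      using w(2) c by (intro divide_right_mono) auto
    then have "(dist x w)\<^sup>2 / (2 * c)
        \<le> (dist x u)\<^sup>2 / (2 * c) / 2 + (dist x v)\<^sup>2 / (2 * c) / 2 - (dist u v)\<^sup>2 / (8 * c)"
      by (simp add: add_divide_distrib diff_divide_distrib)
    then have "\<phi> w \<le> (\<phi> u + \<phi> v) / 2 - (dist u v)\<^sup>2 / (8 * c)"
      using w(1) unfolding \<phi>_def by (simp add: add_divide_distrib)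
    then have "(dist u v)\<^sup>2 / (8 * c) \<le> e"
      using m_le[of w] that by (simp add: field_simps)
    then show ?thesis
      using c by (simp add: field_simps)
  qed
  have "Cauchy y"
  proof (rule metric_CauchyI)
    fix e :: real assume e: "0 < e"
    then have "0 < e\<^sup>2 / (8 * c)"
      using c by simp
    then obtain N where N: "inverse (real (Suc N)) < e\<^sup>2 / (8 * c)"
      using reals_Archimedean by blast
    have "dist (y i) (y j) < e" if "N \<le> i" "N \<le> j" for i j
    proof -
      have "inverse (real (Suc k)) \<le> inverse (real (Suc N))" if "N \<le> k" for k
        using that by (intro le_imp_inverse_le) auto
      then have "\<phi> (y k) \<le> m + inverse (real (Suc N))" if "N \<le> k" for k
        using y[of k] that by (smt (verit))
      then have "(dist (y i) (y j))\<^sup>2 \<le> 8 * c * inverse (real (Suc N))"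
        using that by (intro close) auto
      also have "\<dots> < e\<^sup>2"
        using N c by (simp add: field_simps)
      finally show ?thesis
        using e by (meson less_eq_real_def power2_less_imp_less)
    qed
    then show "\<exists>M. \<forall>m\<ge>M. \<forall>n\<ge>M. dist (y m) (y n) < e" by blast
  qed
  then obtain p where p: "y \<longlonglongrightarrow> p"
    using hadamard unfolding hadamard_space_def complete_def by blast
  have "(\<lambda>n. g (y n)) \<longlonglongrightarrow> g p"
  proof (rule LIM_zero_cancel, rule Lim_null_comparison)
    show "\<forall>\<^sub>F n in sequentially. norm (g (y n) - g p) \<le> L * dist (y n) p"
      using convex_lipschitzD(2)[OF g] by simp
    show "(\<lambda>n. L * dist (y n) p) \<longlonglongrightarrow> 0"
      using p by (intro tendsto_mult_right_zero) (simp add: tendsto_dist_iff[symmetric])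
  qed
  then have "(\<lambda>n. \<phi> (y n)) \<longlonglongrightarrow> \<phi> p"
    unfolding \<phi>_def using p c by (intro tendsto_intros) auto
  moreover have "(\<lambda>n. m + inverse (real (Suc n))) \<longlonglongrightarrow> m + 0"
    by (intro tendsto_intros LIMSEQ_inverse_real_of_nat)
  ultimately have "\<phi> p \<le> m + 0"
    using y by (intro LIMSEQ_le) (auto intro: less_imp_le)
  then have "\<forall>y. \<phi> p \<le> \<phi> y"
    using m_le by (auto intro: order_trans)
  then show ?thesis
    unfolding \<phi>_def by blast
qed

text \<open>\<open>arg_min\<close> is a choice operator; existence of a minimizer is what gives its
  value a meaning.\<close>

lemma prox_minimizes:
  fixes x :: 'h
  assumes c: "0 < c" and g: "convex_lipschitz L g"
  shows "g (rprox c g x) + (dist x (rprox c g x))\<^sup>2 / (2 * c) \<le> g y + (dist x y)\<^sup>2 / (2 * c)"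
proof -
  let ?\<phi> = "\<lambda>y. ereal (g y) + ereal ((dist x y)\<^sup>2 / (2 * c))"
  have "\<exists>p. is_arg_min ?\<phi> (\<lambda>_. True) p"
    using prox_minimizer_exists[OF assms] by (auto simp: is_arg_min_linorder)
  then have "is_arg_min ?\<phi> (\<lambda>_. True) (rprox c g x)"
    unfolding prox_def arg_min_def using c by (auto intro: someI_ex)
  then show ?thesis
    by (auto simp: is_arg_min_linorder)
qed

text \<open>Strong convexity of \<open>2 c g + d(x,.)^2\<close>: the minimal value is compared with
  the value at parameter \<open>t\<close> on the geodesic from \<open>p\<close> to \<open>z\<close>;
  the result is divided by \<open>t\<close>, and then \<open>t\<close> tends to 0.\<close>

lemma prox_variational_inequality:
  fixes x :: 'h
  assumes c: "0 < c" and g: "convex_lipschitz L g"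
  shows "2 * c * g (rprox c g x) + (dist x (rprox c g x))\<^sup>2 + (dist (rprox c g x) z)\<^sup>2
    \<le> 2 * c * g z + (dist x z)\<^sup>2"
proof -
  define p where "p = rprox c g x"
  define \<phi> where "\<phi> y = 2 * c * g y + (dist x y)\<^sup>2" for y
  have min: "\<phi> p \<le> \<phi> y" for y
    using mult_left_mono[OF prox_minimizes[OF assms, of x y], of "2 * c"] c
    unfolding p_def \<phi>_def by (simp add: distrib_left)
  have bound: "\<phi> p + (1 - t) * (dist p z)\<^sup>2 \<le> \<phi> z" if t: "0 < t" "t < 1" for t
  proof -
    obtain w where w: "g w \<le> (1 - t) * g p + t * g z"
      "(dist x w)\<^sup>2 \<le> (1 - t) * (dist x p)\<^sup>2 + t * (dist x z)\<^sup>2 - t * (1 - t) * (dist p z)\<^sup>2"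
      using hadamard_point_between[of t p z] g t by (metis less_eq_real_def)
    have "2 * c * g w \<le> 2 * c * ((1 - t) * g p + t * g z)"
      using w(1) c by (intro mult_left_mono) auto
    then have "\<phi> w \<le> (1 - t) * \<phi> p + t * \<phi> z - t * (1 - t) * (dist p z)\<^sup>2"
      using w(2) unfolding \<phi>_def by (simp add: algebra_simps)
    then have "t * (\<phi> p + (1 - t) * (dist p z)\<^sup>2) \<le> t * \<phi> z"
      using min[of w] by (simp add: algebra_simps)
    then show ?thesis
      using t by simp
  qed
  have "((\<lambda>t. \<phi> p + (1 - t) * (dist p z)\<^sup>2) \<longlongrightarrow> \<phi> p + (1 - 0) * (dist p z)\<^sup>2) (at_right (0::real))"
    by (intro tendsto_intros)
  moreover have "\<forall>\<^sub>F t in at_right (0::real). \<phi> p + (1 - t) * (dist p z)\<^sup>2 \<le> \<phi> z"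
    using eventually_at_right_less[of "0::real"] eventually_at_right_real[of 0 "1::real"]
    by (auto elim: eventually_mono intro: bound)
  ultimately have "\<phi> p + (1 - 0) * (dist p z)\<^sup>2 \<le> \<phi> z"
    by (intro tendsto_upperbound) auto
  then show ?thesis
    unfolding \<phi>_def p_def by simp
qed

section \<open>Displacement and stability of proximal points\<close>

text \<open>The variational inequality at \<open>z = x\<close> bounds the squared displacement by
  \<open>c\<close> times the decrease of \<open>g\<close>, and the Lipschitz bound cancels one
  factor of the distance.\<close>

lemma dist_prox_le:
  fixes x :: 'h
  assumes c: "0 < c" and g: "convex_lipschitz L g"
  shows "dist x (rprox c g x) \<le> c * L"
proof -
  define d where "d = dist x (rprox c g x)"
  have "d * d \<le> c * (g x - g (rprox c g x))"
    using prox_variational_inequality[OF assms, of x x]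
    by (simp add: d_def dist_commute power2_eq_square algebra_simps)
  also have "\<dots> \<le> c * (L * d)"
    using convex_lipschitzD(3)[OF g] c by (intro mult_left_mono) (auto simp: d_def)
  finally have "d * d \<le> (c * L) * d"
    by simp
  moreover have "0 \<le> d" "0 \<le> c * L"
    using c convex_lipschitzD(1)[OF g] by (auto simp: d_def)
  ultimately show ?thesis
    unfolding d_def[symmetric] by (cases "d = 0") auto
qed

text \<open>Each proximal point is tested in the inequality of the other and the two are added; only
  a Lipschitz constant of \<open>c g - c' g'\<close> survives. Changing the step size, removing a
  sample and enlarging the sample are all instances.\<close>

lemma dist_prox_perturb_le:
  fixes z :: 'h
  assumes c: "0 < c" "0 < c'" and g: "convex_lipschitz L g" "convex_lipschitz L' g'"
    and \<epsilon>: "0 \<le> \<epsilon>" "\<And>x y. (c * g x - c' * g' x) - (c * g y - c' * g' y) \<le> \<epsilon> * dist x y"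
  shows "dist (rprox c g z) (rprox c' g' z) \<le> \<epsilon>"
proof -
  define p where "p = rprox c g z"
  define p' where "p' = rprox c' g' z"
  have "2 * c * g p + (dist z p)\<^sup>2 + (dist p p')\<^sup>2 \<le> 2 * c * g p' + (dist z p')\<^sup>2"
    unfolding p_def by (rule prox_variational_inequality[OF c(1) g(1)])
  moreover have "2 * c' * g' p' + (dist z p')\<^sup>2 + (dist p p')\<^sup>2 \<le> 2 * c' * g' p + (dist z p)\<^sup>2"
    using prox_variational_inequality[OF c(2) g(2), of z p] unfolding p'_def by (simp add: dist_commute)
  moreover have "(c * g p' - c' * g' p') - (c * g p - c' * g' p) \<le> \<epsilon> * dist p p'"
    using \<epsilon>(2)[of p' p] by (simp add: dist_commute)
  ultimately have "dist p p' * dist p p' \<le> \<epsilon> * dist p p'"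
    unfolding power2_eq_square by linarith
  then show ?thesis
    unfolding p_def[symmetric] p'_def[symmetric] using \<epsilon>(1) by (cases "dist p p' = 0") auto
qed

text \<open>Proximal maps are even nonexpansive, but this weaker estimate needs no more than the
  variational inequality.\<close>

lemma dist_prox_prox_le:
  fixes x y :: 'h
  assumes c: "0 < c" and g: "convex_lipschitz L g"
  shows "(dist (rprox c g x) (rprox c g y))\<^sup>2 \<le> dist x y * (2 * (c * L) + dist x y)"
proof -
  define p where "p = rprox c g x"
  define q where "q = rprox c g y"
  have "2 * c * g p + (dist x p)\<^sup>2 + (dist p q)\<^sup>2 \<le> 2 * c * g q + (dist x q)\<^sup>2"
    unfolding p_def by (rule prox_variational_inequality[OF c g])
  moreover have "2 * c * g q + (dist y q)\<^sup>2 + (dist p q)\<^sup>2 \<le> 2 * c * g p + (dist y p)\<^sup>2"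
    using prox_variational_inequality[OF c g, of y p] unfolding q_def by (simp add: dist_commute)
  \<comment> \<open>The terms are paired by their common endpoint, so each difference is controlled
    by \<open>dist x y\<close>.\<close>
  ultimately have *: "2 * (dist p q)\<^sup>2 \<le> ((dist x q)\<^sup>2 - (dist y q)\<^sup>2) + ((dist y p)\<^sup>2 - (dist x p)\<^sup>2)"
    by linarith
  have b: "dist x p \<le> c * L" "dist y q \<le> c * L"
    unfolding p_def q_def using dist_prox_le[OF c g] by auto
  have square: "(dist u w)\<^sup>2 - (dist v w)\<^sup>2 \<le> dist u v * (2 * dist v w + dist u v)" for u v w :: 'h
  proof -
    have "dist u w \<le> dist u v + dist v w"
      by (rule dist_triangle)
    then have "(dist u w)\<^sup>2 \<le> (dist u v + dist v w)\<^sup>2"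
      by (intro power_mono) auto
    then show ?thesis
      by (simp add: power2_eq_square algebra_simps)
  qed
  have "dist x y * (2 * dist y q + dist x y) \<le> dist x y * (2 * (c * L) + dist x y)"
    "dist x y * (2 * dist x p + dist x y) \<le> dist x y * (2 * (c * L) + dist x y)"
    using b by (auto intro!: mult_left_mono)
  then show ?thesis
    using * square[of x q y] square[of y p x] unfolding p_def[symmetric] q_def[symmetric]
    by (simp add: dist_commute)
qed

section \<open>Proximal products and the gradient flow\<close>

text \<open>Each step of the cycle evaluates its function at the current point. Moving that
  evaluation back to the start \<open>x\<close> costs a Lipschitz constant times the displacement so
  far, which is at most \<open>c\<close> times the sum of the constants. The cycle thus acts like
  one explicit step for the sum, with a quadratic error.\<close>

lemma prox_product_step:
  fixes x :: 'h and L :: "nat \<Rightarrow> real"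
  assumes c: "0 < c" and g: "\<And>i. 1 \<le> i \<Longrightarrow> convex_lipschitz (L i) (g i)"
  defines "Q n \<equiv> prox_product (\<lambda>i y. ereal (g i y)) c n x"
  shows "(dist (Q n) z)\<^sup>2 \<le> (dist x z)\<^sup>2 - 2 * c * ((\<Sum>i=1..n. g i x) - (\<Sum>i=1..n. g i z))
      + 2 * (c * (\<Sum>i=1..n. L i))\<^sup>2"
proof -
  have Q0: "Q 0 = x" and QS: "Q (Suc n) = rprox c (g (Suc n)) (Q n)" for n
    by (simp_all add: Q_def prox_product_def)
  define S where "S n = (\<Sum>i=1..n. L i)" for n
  have SS: "S (Suc n) = S n + L (Suc n)" for n
    by (simp add: S_def)
  have S0: "0 \<le> S n" for n
    unfolding S_def using g convex_lipschitzD(1) by (intro sum_nonneg) auto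
  have d: "dist x (Q n) \<le> c * S n" for n
  proof (induction n)
    case (Suc n)
    have "dist x (Q (Suc n)) \<le> dist x (Q n) + dist (Q n) (Q (Suc n))"
      by (rule dist_triangle)
    also have "\<dots> \<le> c * S n + c * L (Suc n)"
      using Suc dist_prox_le[OF c g[of "Suc n"], of "Q n"] by (simp add: QS)
    finally show ?case
      by (simp add: SS algebra_simps)
  qed (simp add: Q0 S_def)
  have "(dist (Q n) z)\<^sup>2 \<le> (dist x z)\<^sup>2 - 2 * c * ((\<Sum>i=1..n. g i x) - (\<Sum>i=1..n. g i z))
      + 2 * (c * S n)\<^sup>2"
  proof (induction n)
    case (Suc n)
    define l where "l = L (Suc n)"
    define h where "h = g (Suc n)"
    have h: "convex_lipschitz l h"
      using g[of "Suc n"] by (simp add: l_def h_def)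
    have l: "0 \<le> l"
      using convex_lipschitzD(1)[OF h] .
    have "2 * c * h (Q (Suc n)) + (dist (Q n) (Q (Suc n)))\<^sup>2 + (dist (Q (Suc n)) z)\<^sup>2
        \<le> 2 * c * h z + (dist (Q n) z)\<^sup>2"
      using prox_variational_inequality[OF c h, of "Q n" z] by (simp add: QS h_def)
    then have 1: "(dist (Q (Suc n)) z)\<^sup>2 \<le> (dist (Q n) z)\<^sup>2 + 2 * c * (h z - h (Q (Suc n)))"
      by (simp add: algebra_simps) (smt (verit) zero_le_power2)
    have "h x - h (Q (Suc n)) \<le> l * dist x (Q (Suc n))"
      by (rule convex_lipschitzD(3)[OF h])
    also have "\<dots> \<le> l * (c * (S n + l))"
      using d[of "Suc n"] l by (intro mult_left_mono) (auto simp: SS l_def)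
    finally have "2 * c * (h z - h (Q (Suc n))) \<le> 2 * c * (h z - h x + l * (c * (S n + l)))"
      using c by (intro mult_left_mono) auto
    \<comment> \<open>The error \<open>2 c^2 l (S + l)\<close> of one step is at most the increase
      of \<open>2 (c S)^2\<close> when \<open>S\<close> grows by \<open>l\<close>; hence the errors
      telescope.\<close>
    moreover have "2 * c * (h z - h x + l * (c * (S n + l)))
        \<le> 2 * c * (h z - h x) + 2 * (c * (S n + l))\<^sup>2 - 2 * (c * S n)\<^sup>2"
    proof -
      have "0 \<le> c\<^sup>2 * (l * S n)"
        using l S0[of n] by simp
      then show ?thesis
        by (simp add: power2_eq_square algebra_simps)
    qed
    ultimately show ?case
      using 1 Suc by (simp add: SS l_def[symmetric] h_def[symmetric] algebra_simps)
  qed (simp add: Q0 S_def)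
  then show "(dist (Q n) z)\<^sup>2 \<le> (dist x z)\<^sup>2 - 2 * c * ((\<Sum>i=1..n. g i x) - (\<Sum>i=1..n. g i z))
      + 2 * (c * (\<Sum>i=1..n. L i))\<^sup>2"
    by (simp add: S_def)
qed

text \<open>The cycle is explicit to first order (it evaluates the mean at \<open>x\<close>), the proximal map implicit.
  Adding the two variational inequalities, all function values cancel, so that the squared distance
  of the iterates grows by \<open>O(\<delta>\<^sup>2)\<close> only in each step.\<close>

lemma dist_prox_product_iterates_le:
  fixes x :: 'h and L :: "nat \<Rightarrow> real"
  assumes \<delta>: "0 < \<delta>" and N: "0 < N" and g: "\<And>i. 1 \<le> i \<Longrightarrow> convex_lipschitz (L i) (g i)"
    and M: "(\<Sum>i=1..N. L i) \<le> real N * M"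
  shows "(dist ((prox_product (\<lambda>i y. ereal (g i y)) (\<delta> / real N) N ^^ k) x)
            ((rprox \<delta> (\<lambda>y. inverse (real N) * (\<Sum>i=1..N. g i y)) ^^ k) x))\<^sup>2
      \<le> 2 * real k * (\<delta> * M)\<^sup>2"
proof (induction k)
  case (Suc k)
  let ?Q = "prox_product (\<lambda>i y. ereal (g i y)) (\<delta> / real N) N"
  let ?G = "\<lambda>y. inverse (real N) * (\<Sum>i=1..N. g i y)"
  define u where "u = (?Q ^^ k) x"
  define v where "v = (rprox \<delta> ?G ^^ k) x"
  define w where "w = rprox \<delta> ?G v"
  have S0: "0 \<le> (\<Sum>i=1..N. L i)"
    using g convex_lipschitzD(1) by (intro sum_nonneg) auto
  have G: "convex_lipschitz (inverse (real N) * (\<Sum>i=1..N. L i)) ?G"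
    using g by (intro convex_lipschitz_sum) auto
  have "2 * \<delta> * ?G w + (dist v w)\<^sup>2 + (dist w u)\<^sup>2 \<le> 2 * \<delta> * ?G u + (dist v u)\<^sup>2"
    unfolding w_def by (rule prox_variational_inequality[OF \<delta> G])
  moreover have "(dist (?Q u) w)\<^sup>2 \<le> (dist u w)\<^sup>2
      - 2 * (\<delta> / real N) * ((\<Sum>i=1..N. g i u) - (\<Sum>i=1..N. g i w)) + 2 * (\<delta> / real N * (\<Sum>i=1..N. L i))\<^sup>2"
    using \<delta> N by (intro prox_product_step[OF _ g]) auto
  moreover have "2 * (\<delta> / real N) * ((\<Sum>i=1..N. g i u) - (\<Sum>i=1..N. g i w)) = 2 * \<delta> * ?G u - 2 * \<delta> * ?G w"
    by (simp add: divide_inverse algebra_simps)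
  \<comment> \<open>Bounding the mean of the Lipschitz constants makes the error of a cycle
    independent of its length.\<close>
  moreover have "(\<delta> / real N * (\<Sum>i=1..N. L i))\<^sup>2 \<le> (\<delta> * M)\<^sup>2"
  proof (rule power_mono)
    have "\<delta> * (\<Sum>i=1..N. L i) \<le> \<delta> * (real N * M)"
      using M \<delta> by (intro mult_left_mono) auto
    then show "\<delta> / real N * (\<Sum>i=1..N. L i) \<le> \<delta> * M"
      using N by (simp add: field_simps)
    show "0 \<le> \<delta> / real N * (\<Sum>i=1..N. L i)"
      using S0 \<delta> by simp
  qed
  ultimately have "(dist (?Q u) w)\<^sup>2 \<le> (dist u v)\<^sup>2 + 2 * (\<delta> * M)\<^sup>2"
    by (smt (verit) zero_le_power2 dist_commute)
  moreover have "(dist u v)\<^sup>2 \<le> 2 * real k * (\<delta> * M)\<^sup>2"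
    using Suc by (simp only: u_def v_def)
  ultimately have "(dist (?Q u) w)\<^sup>2 \<le> 2 * real (Suc k) * (\<delta> * M)\<^sup>2"
    by (simp add: algebra_simps)
  then show ?case
    by (simp only: funpow.simps o_apply u_def v_def w_def)
qed simp

text \<open>The preceding estimate with the same \<open>g\<close> in every slot: a cycle then
  consists of \<open>N\<close> iterates of one proximal map with step
  \<open>\<delta> / N\<close>.\<close>

lemma dist_prox_iterates_refine:
  fixes x :: 'h
  assumes \<delta>: "0 < \<delta>" and N: "0 < N" and g: "convex_lipschitz M g"
  shows "(dist ((rprox (\<delta> / real N) g ^^ (N * k)) x) ((rprox \<delta> g ^^ k) x))\<^sup>2 \<le> 2 * real k * (\<delta> * M)\<^sup>2"
proof -
  have 1: "prox_product (\<lambda>i y. ereal (g y)) c n = rprox c g ^^ n" for c n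
    by (induction n) (simp_all add: prox_product_def fun_eq_iff)
  have 2: "inverse (real N) * (\<Sum>i=1..N. g y) = g y" for y
    using N by (simp add: mult.assoc[symmetric])
  show ?thesis
    using dist_prox_product_iterates_le[OF \<delta> N, of "\<lambda>_. M" "\<lambda>_. g" M k x, unfolded 1 2] g
    by (simp add: funpow_mult mult.commute)
qed

text \<open>Both schemes are compared with their common refinement into \<open>m * n\<close> steps.
  The rate depends on \<open>g\<close> only through \<open>M\<close>, so it is uniform over all
  empirical means with a common Lipschitz bound.\<close>

lemma dist_prox_iterates_le:
  fixes x :: 'h
  assumes t: "0 < t" and mn: "0 < m" "0 < n" and g: "convex_lipschitz M g"
  shows "dist ((rprox (t / real m) g ^^ m) x) ((rprox (t / real n) g ^^ n) x)
    \<le> sqrt (2 / real m) * (t * M) + sqrt (2 / real n) * (t * M)"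
proof -
  have *: "dist ((rprox (t / (real n * real m)) g ^^ (n * m)) x) ((rprox (t / real m) g ^^ m) x)
      \<le> sqrt (2 / real m) * (t * M)" if "0 < m" "0 < n" for m n
  proof (rule power2_le_imp_le)
    have "(dist ((rprox (t / real m / real n) g ^^ (n * m)) x) ((rprox (t / real m) g ^^ m) x))\<^sup>2
        \<le> 2 * real m * (t / real m * M)\<^sup>2"
      using t that g by (intro dist_prox_iterates_refine) auto
    also have "\<dots> = (sqrt (2 / real m) * (t * M))\<^sup>2"
      using that by (simp add: power_mult_distrib power_divide power2_eq_square field_simps)
    finally show "(dist ((rprox (t / (real n * real m)) g ^^ (n * m)) x) ((rprox (t / real m) g ^^ m) x))\<^sup>2
        \<le> (sqrt (2 / real m) * (t * M))\<^sup>2"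
      by (simp add: mult.commute)
    show "0 \<le> sqrt (2 / real m) * (t * M)"
      using t convex_lipschitzD(1)[OF g] by simp
  qed
  have "dist ((rprox (t / real m) g ^^ m) x) ((rprox (t / real n) g ^^ n) x)
      \<le> dist ((rprox (t / (real n * real m)) g ^^ (n * m)) x) ((rprox (t / real m) g ^^ m) x)
       + dist ((rprox (t / (real n * real m)) g ^^ (n * m)) x) ((rprox (t / real n) g ^^ n) x)"
    by (rule dist_triangle3)
  also have "\<dots> \<le> sqrt (2 / real m) * (t * M) + sqrt (2 / real n) * (t * M)"
    using *[of m n] *[of n m] mn by (simp add: mult.commute)
  finally show ?thesis .
qed

section \<open>Convergence of proximal schemes to the gradient flow\<close>

lemma sqrt_inverse_tendsto_0: "(\<lambda>n. sqrt (2 / real n) * a) \<longlonglongrightarrow> 0"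
proof -
  have "(\<lambda>n. sqrt (2 / real n) * a) \<longlonglongrightarrow> sqrt 0 * a"
    by (intro tendsto_mult_right tendsto_real_sqrt lim_const_over_n)
  then show ?thesis by simp
qed

text \<open>The comparison of two step numbers makes the iterates Cauchy, so the \<open>lim\<close>
  in \<open>gradient_flow\<close> is a limit that exists.\<close>

lemma prox_iterates_tendsto_gradient_flow:
  fixes x :: 'h
  assumes t: "0 < t" and g: "convex_lipschitz M g"
  shows "(\<lambda>n. (rprox (t / real n) g ^^ n) x) \<longlonglongrightarrow> gradient_flow (\<lambda>y. ereal (g y)) t x"
proof -
  let ?p = "\<lambda>n. (rprox (t / real n) g ^^ n) x"
  have "Cauchy ?p"
  proof (rule metric_CauchyI)
    fix e :: real assume e: "0 < e"
    have "\<forall>\<^sub>F n in sequentially. sqrt (2 / real n) * (t * M) < e / 2"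
      using e by (intro order_tendstoD(2)[OF sqrt_inverse_tendsto_0]) auto
    then have "\<forall>\<^sub>F n in sequentially. sqrt (2 / real n) * (t * M) < e / 2 \<and> 0 < n"
      using eventually_gt_at_top by (rule eventually_conj)
    then obtain K where K: "\<And>n. K \<le> n \<Longrightarrow> sqrt (2 / real n) * (t * M) < e / 2 \<and> 0 < n"
      unfolding eventually_sequentially by blast
    have "dist (?p m) (?p n) < e" if "K \<le> m" "K \<le> n" for m n
      using dist_prox_iterates_le[OF t _ _ g, of m n x] K[OF that(1)] K[OF that(2)] by linarith
    then show "\<exists>K. \<forall>m\<ge>K. \<forall>n\<ge>K. dist (?p m) (?p n) < e" by blast
  qed
  then have "convergent ?p"
    using hadamard unfolding hadamard_space_def complete_def convergent_def by blast
  then show ?thesis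
    using t by (simp add: gradient_flow_def convergent_LIMSEQ_iff)
qed

text \<open>In the induction step both the function and the point vary. The common constant
  \<open>M\<close> makes the proximal maps equicontinuous, which takes care of the moving
  point.\<close>

lemma prox_iterates_tendsto:
  fixes x :: 'h
  assumes c: "0 < c" and G: "\<And>n. convex_lipschitz M (G n)"
    and lim: "\<And>z. (\<lambda>n. rprox c (G n) z) \<longlonglongrightarrow> rprox c F z"
  shows "(\<lambda>n. (rprox c (G n) ^^ k) x) \<longlonglongrightarrow> (rprox c F ^^ k) x"
proof (induction k)
  case (Suc k)
  let ?u = "\<lambda>n. (rprox c (G n) ^^ k) x" and ?v = "(rprox c F ^^ k) x"
  have d: "(\<lambda>n. dist (?u n) ?v) \<longlonglongrightarrow> 0"
    using Suc by (simp add: tendsto_dist_iff[symmetric])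
  have "(\<lambda>n. sqrt (dist (?u n) ?v * (2 * (c * M) + dist (?u n) ?v)) + dist (rprox c (G n) ?v) (rprox c F ?v))
      \<longlonglongrightarrow> sqrt (0 * (2 * (c * M) + 0)) + 0"
    using d lim[of ?v] by (intro tendsto_intros tendsto_real_sqrt) (simp_all add: tendsto_dist_iff[symmetric])
  then have bound0: "(\<lambda>n. sqrt (dist (?u n) ?v * (2 * (c * M) + dist (?u n) ?v)) + dist (rprox c (G n) ?v) (rprox c F ?v))
      \<longlonglongrightarrow> 0"
    by simp
  have le: "dist (rprox c (G n) (?u n)) (rprox c F ?v)
      \<le> sqrt (dist (?u n) ?v * (2 * (c * M) + dist (?u n) ?v)) + dist (rprox c (G n) ?v) (rprox c F ?v)" for n
  proof -
    have "dist (rprox c (G n) (?u n)) (rprox c (G n) ?v) \<le> sqrt (dist (?u n) ?v * (2 * (c * M) + dist (?u n) ?v))"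
      by (intro real_le_rsqrt dist_prox_prox_le[OF c G])
    then show ?thesis
      using dist_triangle[of "rprox c (G n) (?u n)" "rprox c F ?v" "rprox c (G n) ?v"] by linarith
  qed
  have "(\<lambda>n. dist (rprox c (G n) (?u n)) (rprox c F ?v)) \<longlonglongrightarrow> 0"
    by (intro Lim_null_comparison[OF _ bound0] always_eventually allI order_trans[OF _ le]) simp
  then show ?case
    by (simp add: tendsto_dist_iff[symmetric])
qed simp

text \<open>A chain of four comparisons: the cycles with \<open>n\<close> proximal steps for
  \<open>G n\<close>, these with \<open>m\<close> steps for \<open>G n\<close>, these with
  \<open>m\<close> steps for \<open>F\<close>, and these with the flow. The number \<open>m\<close>
  is fixed before \<open>n\<close> grows, because convergence of resolvents is passed on to a fixed
  number of iterates.\<close>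

lemma prox_product_tendsto_gradient_flow:
  fixes x :: 'h and L :: "nat \<Rightarrow> real"
  assumes t: "0 < t" and g: "\<And>i. 1 \<le> i \<Longrightarrow> convex_lipschitz (L i) (g i)"
    and F: "convex_lipschitz M F"
    and M: "\<And>n. (\<Sum>i=1..n. L i) \<le> real n * M"
    and lim: "\<And>c z. 0 < c \<Longrightarrow>
      (\<lambda>n. rprox c (\<lambda>y. inverse (real n) * (\<Sum>i=1..n. g i y)) z) \<longlonglongrightarrow> rprox c F z"
  shows "(\<lambda>n. (prox_product (\<lambda>i y. ereal (g i y)) (t / (real n)\<^sup>2) n ^^ n) x)
    \<longlonglongrightarrow> gradient_flow (\<lambda>y. ereal (F y)) t x"
proof -
  define G where "G n = (\<lambda>y. inverse (real n) * (\<Sum>i=1..n. g i y))" for n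
  let ?Q = "\<lambda>n. (prox_product (\<lambda>i y. ereal (g i y)) (t / (real n)\<^sup>2) n ^^ n) x"
  let ?p = "\<lambda>G m. (rprox (t / real m) G ^^ m) x"
  let ?S = "gradient_flow (\<lambda>y. ereal (F y)) t x"
  define E where "E n = sqrt (2 / real n) * (t * M)" for n
  have M0: "0 \<le> M"
    using convex_lipschitzD(1)[OF F] .
  have G: "convex_lipschitz M (G n)" for n
  proof (rule convex_lipschitz_mono)
    show "convex_lipschitz (inverse (real n) * (\<Sum>i=1..n. L i)) (G n)"
      unfolding G_def using g by (intro convex_lipschitz_sum) auto
    show "inverse (real n) * (\<Sum>i=1..n. L i) \<le> M"
      using M[of n] M0 by (cases "n = 0") (auto simp: field_simps)
  qed
  have E: "E \<longlonglongrightarrow> 0"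
    unfolding E_def by (rule sqrt_inverse_tendsto_0)
  \<comment> \<open>Since \<open>t / n^2 = (t / n) / n\<close>, this is the cycle estimate with
    \<open>\<delta> = t / n\<close>, iterated \<open>n\<close> times.\<close>
  have Q: "dist (?Q n) (?p (G n) n) \<le> E n" if "0 < n" for n
  proof (rule power2_le_imp_le)
    have "(dist ((prox_product (\<lambda>i y. ereal (g i y)) (t / real n / real n) n ^^ n) x)
            ((rprox (t / real n) (G n) ^^ n) x))\<^sup>2 \<le> 2 * real n * (t / real n * M)\<^sup>2"
      unfolding G_def using t that g M by (intro dist_prox_product_iterates_le) auto
    also have "\<dots> = (E n)\<^sup>2"
      using that by (simp add: E_def power_mult_distrib power_divide power2_eq_square field_simps)
    finally show "(dist (?Q n) (?p (G n) n))\<^sup>2 \<le> (E n)\<^sup>2"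
      by (simp add: power2_eq_square)
    show "0 \<le> E n"
      using t M0 by (simp add: E_def)
  qed
  have fixed: "(\<lambda>n. ?p (G n) m) \<longlonglongrightarrow> ?p F m" if "0 < m" for m
    using t that G lim unfolding G_def by (intro prox_iterates_tendsto) auto
  have flow: "(\<lambda>m. ?p F m) \<longlonglongrightarrow> ?S"
    using prox_iterates_tendsto_gradient_flow[OF t F] .
  show ?thesis
  proof (rule metric_LIMSEQ_I)
    fix e :: real assume e: "0 < e"
    have ev: "\<forall>\<^sub>F m in sequentially. E m < e / 5"
      using e by (intro order_tendstoD(2)[OF E]) auto
    have "\<forall>\<^sub>F m in sequentially. dist (?p F m) ?S < e / 5"
      using flow e by (intro tendstoD) auto
    then have "\<forall>\<^sub>F m in sequentially. E m < e / 5 \<and> dist (?p F m) ?S < e / 5 \<and> 0 < m"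
      using ev eventually_gt_at_top[of 0] by eventually_elim simp
    then obtain m where m: "E m < e / 5" "dist (?p F m) ?S < e / 5" "0 < m"
      using eventually_happens'[OF sequentially_bot] by blast
    have "\<forall>\<^sub>F n in sequentially. dist (?p (G n) m) (?p F m) < e / 5"
      using fixed[OF m(3)] e by (intro tendstoD) auto
    then have "\<forall>\<^sub>F n in sequentially. dist (?Q n) ?S < e"
      using ev eventually_gt_at_top[of 0]
    proof eventually_elim
      case (elim n)
      have "dist (?p (G n) n) (?p (G n) m) \<le> E n + E m"
        unfolding E_def using elim m G by (intro dist_prox_iterates_le[OF t]) auto
      moreover have "dist (?Q n) ?S \<le> dist (?Q n) (?p (G n) n) + dist (?p (G n) n) (?p (G n) m)
          + dist (?p (G n) m) (?p F m) + dist (?p F m) ?S"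
        using dist_triangle[of "?Q n" ?S "?p F m"] dist_triangle[of "?Q n" "?p F m" "?p (G n) m"]
          dist_triangle[of "?Q n" "?p (G n) m" "?p (G n) n"] by linarith
      ultimately show ?case
        using Q[of n] elim m by linarith
    qed
    then show "\<exists>no. \<forall>n\<ge>no. dist (?Q n) ?S < e"
      unfolding eventually_sequentially .
  qed
qed

end

section \<open>Measurability of proximal points\<close>

lemma convex_lipschitz_continuous:
  assumes "convex_lipschitz L g"
  shows "continuous_on UNIV g"
proof (rule lipschitz_on_continuous_on)
  show "L-lipschitz_on UNIV g"
    using convex_lipschitzD(1,2)[OF assms] by (intro lipschitz_onI) (auto simp: dist_real_def)
qed

lemma countable_dense_seq:
  obtains d :: "nat \<Rightarrow> 'h::second_countable_topology"
  where "\<And>X. open X \<Longrightarrow> X \<noteq> {} \<Longrightarrow> \<exists>i. d i \<in> X"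
proof -
  obtain D :: "'h set" where D: "countable D" "\<And>X. open X \<Longrightarrow> X \<noteq> {} \<Longrightarrow> \<exists>d\<in>D. d \<in> X"
    using countable_dense_exists by blast
  have "D \<noteq> {}"
    using D(2)[of UNIV] by auto
  then have "range (from_nat_into D) = D"
    using D(1) by (rule range_from_nat_into)
  then show thesis
    using D(2) by (intro that[of "from_nat_into D"]) (metis imageE)
qed

text \<open>Rounding \<open>X\<close> to the first dense point within \<open>1 / (k + 1)\<close>
  gives a countably valued map, for which measurability at fixed points suffices; continuity of
  \<open>G \<omega>\<close> then passes to the limit.\<close>

lemma borel_measurable_caratheodory:
  fixes G :: "'a \<Rightarrow> 'h::{metric_space, second_countable_topology} \<Rightarrow> real"
  assumes G: "\<And>x. (\<lambda>\<omega>. G \<omega> x) \<in> borel_measurable N"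
    and cont: "\<And>\<omega>. \<omega> \<in> space N \<Longrightarrow> continuous_on UNIV (G \<omega>)"
    and X[measurable]: "X \<in> borel_measurable N"
  shows "(\<lambda>\<omega>. G \<omega> (X \<omega>)) \<in> borel_measurable N"
proof -
  obtain d :: "nat \<Rightarrow> 'h" where d: "\<And>X. open X \<Longrightarrow> X \<noteq> {} \<Longrightarrow> \<exists>i. d i \<in> X"
    using countable_dense_seq by blast
  define j where "j k \<omega> = (LEAST i. dist (X \<omega>) (d i) < inverse (real (Suc k)))" for k \<omega>
  have j_meas: "j k \<in> measurable N (count_space UNIV)" for k
    unfolding j_def by measurable
  have "\<exists>i. dist (X \<omega>) (d i) < inverse (real (Suc k))" for k \<omega>
    using d[of "ball (X \<omega>) (inverse (real (Suc k)))"] by auto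
  then have j: "dist (X \<omega>) (d (j k \<omega>)) < inverse (real (Suc k))" for k \<omega>
    unfolding j_def by (rule LeastI_ex)
  have lim: "(\<lambda>k. d (j k \<omega>)) \<longlonglongrightarrow> X \<omega>" for \<omega>
  proof (rule tendsto_dist_iff[THEN iffD2],
      rule Lim_null_comparison[OF always_eventually LIMSEQ_inverse_real_of_nat], intro allI)
    show "norm (dist (d (j k \<omega>)) (X \<omega>)) \<le> inverse (real (Suc k))" for k
      using j[of \<omega> k] by (simp add: dist_commute)
  qed
  show ?thesis
  proof (rule borel_measurable_LIMSEQ_metric)
    show "(\<lambda>\<omega>. G \<omega> (d (j k \<omega>))) \<in> borel_measurable N" for k
      by (rule measurable_compose_countable[where f = "\<lambda>i \<omega>. G \<omega> (d i)", OF G j_meas])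
    show "(\<lambda>k. G \<omega> (d (j k \<omega>))) \<longlonglongrightarrow> G \<omega> (X \<omega>)" if "\<omega> \<in> space N" for \<omega>
      by (rule continuous_on_tendsto_compose[OF cont[OF that] lim]) auto
  qed
qed

text \<open>Near-minimizers are selected measurably as the first suitable points of a dense
  sequence, and the variational inequality turns a nearly minimal value into closeness to the
  proximal point.\<close>

lemma borel_measurable_rprox:
  fixes G :: "'a \<Rightarrow> 'h::{metric_space, second_countable_topology} \<Rightarrow> real"
  assumes H: "hadamard_space TYPE('h)" and c: "0 < c"
    and G[measurable]: "\<And>x. (\<lambda>\<omega>. G \<omega> x) \<in> borel_measurable N"
    and cl: "\<And>\<omega>. \<omega> \<in> space N \<Longrightarrow> convex_lipschitz (L \<omega>) (G \<omega>)"
  shows "(\<lambda>\<omega>. rprox c (G \<omega>) z) \<in> borel_measurable N"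
proof -
  obtain d :: "nat \<Rightarrow> 'h" where d: "\<And>X. open X \<Longrightarrow> X \<noteq> {} \<Longrightarrow> \<exists>i. d i \<in> X"
    using countable_dense_seq by blast
  define \<phi> where "\<phi> \<omega> y = 2 * c * G \<omega> y + (dist z y)\<^sup>2" for \<omega> y
  define p where "p \<omega> = rprox c (G \<omega>) z" for \<omega>
  \<comment> \<open>Values are compared with those at dense points only, so that countably many
    measurable conditions determine the index. By continuity the dense points come arbitrarily close
    to the minimum, whence \<open>j\<close> is within \<open>1 / (k + 1)\<close> of it.\<close>
  define j where "j k \<omega> = (LEAST i. \<forall>n. \<phi> \<omega> (d i) \<le> \<phi> \<omega> (d n) + inverse (real (Suc k)))" for k \<omega>
  have \<phi>_meas[measurable]: "(\<lambda>\<omega>. \<phi> \<omega> y) \<in> borel_measurable N" for y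
    unfolding \<phi>_def by measurable
  have j_meas: "j k \<in> measurable N (count_space UNIV)" for k
    unfolding j_def by measurable
  have p: "\<phi> \<omega> (p \<omega>) + (dist (p \<omega>) y)\<^sup>2 \<le> \<phi> \<omega> y" if "\<omega> \<in> space N" for \<omega> y
    using prox_variational_inequality[OF H c cl[OF that], of z y] unfolding \<phi>_def p_def by simp
  have approx: "\<exists>i. \<phi> \<omega> (d i) < \<phi> \<omega> (p \<omega>) + e" if "\<omega> \<in> space N" "0 < e" for \<omega> e
  proof -
    have "continuous_on UNIV (\<phi> \<omega>)"
      unfolding \<phi>_def using convex_lipschitz_continuous[OF cl[OF that(1)]]
      by (intro continuous_intros) auto
    then have "open {y. \<phi> \<omega> y < \<phi> \<omega> (p \<omega>) + e}"
      by (intro open_Collect_less continuous_intros)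
    moreover have "p \<omega> \<in> {y. \<phi> \<omega> y < \<phi> \<omega> (p \<omega>) + e}"
      using that by simp
    ultimately show ?thesis
      using d by blast
  qed
  have j: "\<phi> \<omega> (d (j k \<omega>)) \<le> \<phi> \<omega> (p \<omega>) + inverse (real (Suc k))" if \<omega>: "\<omega> \<in> space N" for k \<omega>
  proof -
    obtain i where i: "\<phi> \<omega> (d i) < \<phi> \<omega> (p \<omega>) + inverse (real (Suc k))"
      using approx[OF \<omega>, of "inverse (real (Suc k))"] by auto
    have "\<phi> \<omega> (d i) \<le> \<phi> \<omega> (d n) + inverse (real (Suc k))" for n
      using i p[OF \<omega>, of "d n"] zero_le_power2[of "dist (p \<omega>) (d n)"] by linarith
    then have *: "\<phi> \<omega> (d (j k \<omega>)) \<le> \<phi> \<omega> (d n) + inverse (real (Suc k))" for n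
      unfolding j_def using LeastI[of "\<lambda>i. \<forall>n. \<phi> \<omega> (d i) \<le> \<phi> \<omega> (d n) + inverse (real (Suc k))" i] by blast
    show ?thesis
    proof (rule field_le_epsilon)
      fix e :: real assume "0 < e"
      then obtain n where "\<phi> \<omega> (d n) < \<phi> \<omega> (p \<omega>) + e"
        using approx[OF \<omega>] by blast
      then show "\<phi> \<omega> (d (j k \<omega>)) \<le> \<phi> \<omega> (p \<omega>) + inverse (real (Suc k)) + e"
        using *[of n] by linarith
    qed
  qed
  have lim: "(\<lambda>k. d (j k \<omega>)) \<longlonglongrightarrow> p \<omega>" if \<omega>: "\<omega> \<in> space N" for \<omega>
  proof -
    have le: "norm (dist (d (j k \<omega>)) (p \<omega>)) \<le> sqrt (inverse (real (Suc k)))" for k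
      using j[OF \<omega>, of k] p[OF \<omega>, of "d (j k \<omega>)"] by (auto intro!: real_le_rsqrt simp: dist_commute)
    have "(\<lambda>k. sqrt (inverse (real (Suc k)))) \<longlonglongrightarrow> sqrt 0"
      by (intro tendsto_real_sqrt LIMSEQ_inverse_real_of_nat)
    then have lim0: "(\<lambda>k. sqrt (inverse (real (Suc k)))) \<longlonglongrightarrow> 0"
      by simp
    have "(\<lambda>k. dist (d (j k \<omega>)) (p \<omega>)) \<longlonglongrightarrow> 0"
      by (rule Lim_null_comparison[OF always_eventually lim0]) (rule allI, rule le)
    then show ?thesis
      by (simp add: tendsto_dist_iff[symmetric])
  qed
  have "p \<in> borel_measurable N"
  proof (rule borel_measurable_LIMSEQ_metric)
    show "(\<lambda>\<omega>. d (j k \<omega>)) \<in> borel_measurable N" for k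
      by (rule measurable_compose_countable[where f = "\<lambda>i \<omega>. d i", OF _ j_meas]) simp
  qed (rule lim)
  then show ?thesis
    by (simp add: p_def[abs_def])
qed

text \<open>Exchanging sum and integral shows that the series of the \<open>Z n\<close> has finite
  mean; it is therefore summable almost surely.\<close>

lemma AE_tendsto_zero_of_summable_integral:
  fixes Z :: "nat \<Rightarrow> 'a \<Rightarrow> real"
  assumes int: "\<And>n. integrable M (Z n)" and nonneg: "\<And>n \<omega>. \<omega> \<in> space M \<Longrightarrow> 0 \<le> Z n \<omega>"
    and sum: "summable (\<lambda>n. integral\<^sup>L M (Z n))"
  shows "AE \<omega> in M. (\<lambda>n. Z n \<omega>) \<longlonglongrightarrow> 0"
proof -
  have [measurable]: "Z n \<in> borel_measurable M" for n
    using int by auto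
  have I0: "0 \<le> integral\<^sup>L M (Z n)" for n
    using nonneg by (intro integral_nonneg_AE) auto
  have "(\<integral>\<^sup>+\<omega>. (\<Sum>n. ennreal (Z n \<omega>)) \<partial>M) = (\<Sum>n. \<integral>\<^sup>+\<omega>. ennreal (Z n \<omega>) \<partial>M)"
    by (intro nn_integral_suminf) auto
  also have "\<dots> = (\<Sum>n. ennreal (integral\<^sup>L M (Z n)))"
    using int nonneg by (intro suminf_cong nn_integral_eq_integral) auto
  also have "\<dots> = ennreal (\<Sum>n. integral\<^sup>L M (Z n))"
    using sum I0 by (intro suminf_ennreal2) auto
  finally have "(\<integral>\<^sup>+\<omega>. (\<Sum>n. ennreal (Z n \<omega>)) \<partial>M) \<noteq> \<infinity>"
    by simp
  then have "AE \<omega> in M. (\<Sum>n. ennreal (Z n \<omega>)) \<noteq> \<infinity>"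
    by (intro nn_integral_noteq_infinite) auto
  then show ?thesis
  proof (rule AE_mp, intro AE_I2 impI)
    fix \<omega> assume "\<omega> \<in> space M" "(\<Sum>n. ennreal (Z n \<omega>)) \<noteq> \<infinity>"
    then have "summable (\<lambda>n. Z n \<omega>)"
      using nonneg by (intro summable_suminf_not_top) auto
    then show "(\<lambda>n. Z n \<omega>) \<longlonglongrightarrow> 0"
      by (rule summable_LIMSEQ_zero)
  qed
qed

section \<open>Resolvents of empirical means\<close>

text \<open>For functions with the common constant \<open>B\<close>, proximal points depend
  continuously on step and centre with a modulus independent of the function. Almost sure
  convergence thus has to be secured for countably many pairs only.\<close>

lemma prox_tendsto_of_dense:
  fixes G :: "nat \<Rightarrow> 'h::metric_space \<Rightarrow> real" and d :: "nat \<Rightarrow> 'h"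
  assumes H: "hadamard_space TYPE('h)"
    and G: "\<And>n. convex_lipschitz B (G n)" and F: "convex_lipschitz B F"
    and lim: "\<And>q i. q \<in> \<rat> \<Longrightarrow> 0 < q \<Longrightarrow> (\<lambda>n. rprox q (G n) (d i)) \<longlonglongrightarrow> rprox q F (d i)"
    and d: "\<And>X. open X \<Longrightarrow> X \<noteq> {} \<Longrightarrow> \<exists>i. d i \<in> X"
    and c: "0 < c"
  shows "(\<lambda>n. rprox c (G n) z) \<longlonglongrightarrow> rprox c F z"
proof (rule tendstoI)
  fix e :: real assume e: "0 < e"
  \<comment> \<open>The first summand pays for moving the step from \<open>c\<close> to a rational
    \<open>q < c + \<delta>\<close>, the second for moving the centre from \<open>z\<close> to a
    dense point within \<open>\<delta>\<close>.\<close>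
  let ?b = "\<lambda>\<delta>. \<delta> * B + sqrt (\<delta> * (2 * ((c + \<delta>) * B) + \<delta>))"
  have B: "0 \<le> B"
    using convex_lipschitzD(1)[OF F] .
  have "(?b \<longlongrightarrow> 0 * B + sqrt (0 * (2 * ((c + 0) * B) + 0))) (at_right 0)"
    by (intro tendsto_intros)
  then have "\<forall>\<^sub>F \<delta> in at_right 0. ?b \<delta> < e / 3"
    using e by (intro order_tendstoD(2)) auto
  then have "\<forall>\<^sub>F \<delta> in at_right 0. ?b \<delta> < e / 3 \<and> 0 < \<delta>"
    using eventually_at_right_less by (rule eventually_conj)
  then obtain \<delta> where \<delta>: "?b \<delta> < e / 3" "0 < \<delta>"
    using eventually_happens'[OF trivial_limit_at_right_real] by blast
  obtain q where q: "q \<in> \<rat>" "c < q" "q < c + \<delta>"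
    using Rats_dense_in_real[of c "c + \<delta>"] \<delta>(2) by auto
  obtain i where i: "dist z (d i) < \<delta>"
    using d[of "ball z \<delta>"] \<delta>(2) by auto
  have q0: "0 < q"
    using c q by simp
  have near: "dist (rprox c K z) (rprox q K (d i)) < e / 3" if K: "convex_lipschitz B K" for K
  proof -
    have "dist (rprox c K z) (rprox q K z) \<le> \<delta> * B"
    proof (rule dist_prox_perturb_le[OF H c q0 K K])
      fix x y
      have "c * K x - q * K x - (c * K y - q * K y) = (q - c) * (K y - K x)"
        by (simp add: algebra_simps)
      also have "\<dots> \<le> \<delta> * (B * dist x y)"
        using q B convex_lipschitzD(3)[OF K, of y x]
        by (intro order_trans[OF mult_left_mono mult_right_mono]) (auto simp: dist_commute)
      finally show "c * K x - q * K x - (c * K y - q * K y) \<le> \<delta> * B * dist x y"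
        by simp
    qed (use \<delta>(2) B in simp)
    moreover have "dist (rprox q K z) (rprox q K (d i)) \<le> sqrt (\<delta> * (2 * ((c + \<delta>) * B) + \<delta>))"
    proof (rule real_le_rsqrt)
      have "(dist (rprox q K z) (rprox q K (d i)))\<^sup>2 \<le> dist z (d i) * (2 * (q * B) + dist z (d i))"
        by (rule dist_prox_prox_le[OF H q0 K])
      also have "\<dots> \<le> \<delta> * (2 * ((c + \<delta>) * B) + \<delta>)"
        using i q q0 B \<delta>(2) by (intro mult_mono add_mono) auto
      finally show "(dist (rprox q K z) (rprox q K (d i)))\<^sup>2 \<le> \<delta> * (2 * ((c + \<delta>) * B) + \<delta>)" .
    qed
    ultimately show ?thesis
      using \<delta>(1) dist_triangle[of "rprox c K z" "rprox q K (d i)" "rprox q K z"] by linarith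
  qed
  have "\<forall>\<^sub>F n in sequentially. dist (rprox q (G n) (d i)) (rprox q F (d i)) < e / 3"
    using e by (intro tendstoD[OF lim[OF q(1) q0]]) simp
  then show "\<forall>\<^sub>F n in sequentially. dist (rprox c (G n) z) (rprox c F z) < e"
  proof eventually_elim
    case (elim n)
    show ?case
      using elim near[OF G[of n]] near[OF F]
        dist_triangle[of "rprox c (G n) z" "rprox c F z" "rprox q (G n) (d i)"]
        dist_triangle[of "rprox q (G n) (d i)" "rprox c F z" "rprox q F (d i)"]
      by (simp add: dist_commute)
  qed
qed

section \<open>Random samples of convex functions\<close>

locale random_convex_functions = prob_space P + \<mu>: prob_space \<mu>
  for P :: "'w measure" and \<mu> :: "'e measure" +
  fixes \<xi> :: "nat \<Rightarrow> 'w \<Rightarrow> 'e" and g :: "'e \<Rightarrow> 'h::polish_space \<Rightarrow> real" and L :: "'e \<Rightarrow> real"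
  assumes hadamard: "hadamard_space TYPE('h)"
    and indep: "indep_vars (\<lambda>_. \<mu>) \<xi> {1..}"
    and distr_\<xi>: "1 \<le> i \<Longrightarrow> distr P \<mu> (\<xi> i) = \<mu>"
    and convex_lipschitz_g: "e \<in> space \<mu> \<Longrightarrow> convex_lipschitz (L e) (g e)"
    and integrable_g: "integrable \<mu> (\<lambda>e. g e x)"
    and measurable_L[measurable]: "L \<in> borel_measurable \<mu>"
    and integrable_L2: "integrable \<mu> (\<lambda>e. (L e)\<^sup>2)"
begin

definition M :: real where "M = (\<integral>e. L e \<partial>\<mu>)"

definition F :: "'h \<Rightarrow> real" where "F x = (\<integral>e. g e x \<partial>\<mu>)"

text \<open>The mean over the samples in \<open>A \<subseteq> {1..n}\<close>, with the weights \<open>1 / n\<close> of the full sample.\<close>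

definition G :: "nat \<Rightarrow> nat set \<Rightarrow> (nat \<Rightarrow> 'e) \<Rightarrow> 'h \<Rightarrow> real" where
  "G n A r x = inverse (real n) * (\<Sum>i\<in>A. g (r i) x)"

lemma measurable_\<xi>: "1 \<le> i \<Longrightarrow> \<xi> i \<in> measurable P \<mu>"
  using indep by (auto simp: indep_vars_def)

lemma \<xi>_space: "1 \<le> i \<Longrightarrow> \<omega> \<in> space P \<Longrightarrow> \<xi> i \<omega> \<in> space \<mu>"
  using measurable_\<xi> by (auto dest: measurable_space)

lemma measurable_g[measurable]: "(\<lambda>e. g e x) \<in> borel_measurable \<mu>"
  using integrable_g by auto

lemma L_nonneg: "e \<in> space \<mu> \<Longrightarrow> 0 \<le> L e"
  using convex_lipschitz_g convex_lipschitzD(1) by blast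

lemma integrable_L: "integrable \<mu> L"
  by (rule \<mu>.square_integrable_imp_integrable[OF measurable_L integrable_L2])

lemma
  fixes h :: "'e \<Rightarrow> real"
  assumes i: "1 \<le> i"
  shows integrable_sample: "integrable \<mu> h \<Longrightarrow> integrable P (\<lambda>\<omega>. h (\<xi> i \<omega>))"
    and integral_sample: "h \<in> borel_measurable \<mu> \<Longrightarrow> (\<integral>\<omega>. h (\<xi> i \<omega>) \<partial>P) = (\<integral>e. h e \<partial>\<mu>)"
  using integrable_distr[OF measurable_\<xi>[OF i], of h] integral_distr[OF measurable_\<xi>[OF i], of h]
  by (simp_all add: distr_\<xi>[OF i])

lemma convex_lipschitz_F: "convex_lipschitz M F"
  unfolding convex_lipschitz_def geodesically_convex_real_iff
proof (intro conjI allI impI ballI)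
  show "0 \<le> M"
    unfolding M_def using L_nonneg by (intro integral_nonneg_AE) auto
next
  fix l :: real and \<gamma> :: "real \<Rightarrow> 'h" and t :: real
  assume \<gamma>: "geodesic l \<gamma>" and t: "t \<in> {0..1}"
  have "F (\<gamma> (t * l)) \<le> (\<integral>e. (1 - t) * g e (\<gamma> 0) + t * g e (\<gamma> l) \<partial>\<mu>)"
    unfolding F_def using integrable_g convex_lipschitz_g \<gamma> t
    by (intro integral_mono) (auto simp: convex_lipschitz_def geodesically_convex_real_iff)
  also have "\<dots> = (1 - t) * F (\<gamma> 0) + t * F (\<gamma> l)"
    unfolding F_def using integrable_g by simp
  finally show "F (\<gamma> (t * l)) \<le> (1 - t) * F (\<gamma> 0) + t * F (\<gamma> l)" .
next
  fix x y
  have "F x - F y \<le> M * dist x y" for x y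
  proof -
    have "F x - F y = (\<integral>e. g e x - g e y \<partial>\<mu>)"
      unfolding F_def using integrable_g by simp
    also have "\<dots> \<le> (\<integral>e. L e * dist x y \<partial>\<mu>)"
      using integrable_g integrable_L convex_lipschitz_g
      by (intro integral_mono) (auto intro: convex_lipschitzD)
    finally show ?thesis
      using integrable_L by (simp add: M_def)
  qed
  from this[of x y] this[of y x] show "\<bar>F x - F y\<bar> \<le> M * dist x y"
    by (simp add: dist_commute)
qed

lemma M_nonneg: "0 \<le> M"
  using convex_lipschitzD(1)[OF convex_lipschitz_F] .

section \<open>Stability of empirical proximal points\<close>

lemma convex_lipschitz_G:
  assumes "finite A" "\<And>i. i \<in> A \<Longrightarrow> r i \<in> space \<mu>"
  shows "convex_lipschitz (inverse (real n) * (\<Sum>i\<in>A. L (r i))) (G n A r)"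
  unfolding G_def using assms convex_lipschitz_g by (intro convex_lipschitz_sum) auto

text \<open>Because the weight \<open>1 / n\<close> is kept after the removal, the two means differ
  by exactly \<open>g (r i) / n\<close>.\<close>

lemma dist_prox_leave_one_out_le:
  assumes c: "0 < c" and r: "\<And>j. j \<in> {1..n} \<Longrightarrow> r j \<in> space \<mu>" and i: "i \<in> {1..n}"
  shows "dist (rprox c (G n {1..n} r) z) (rprox c (G n ({1..n} - {i}) r) z) \<le> c * L (r i) / real n"
proof (rule dist_prox_perturb_le[OF hadamard c c])
  have Li: "convex_lipschitz (L (r i)) (g (r i))"
    using convex_lipschitz_g r i by blast
  show "0 \<le> c * L (r i) / real n"
    using convex_lipschitzD(1)[OF Li] c by simp
  fix x y
  have "G n {1..n} r x = inverse (real n) * g (r i) x + G n ({1..n} - {i}) r x" for x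
    unfolding G_def using sum.remove[OF _ i, of "\<lambda>i. g (r i) x"] by (simp add: distrib_left)
  then have "c * G n {1..n} r x - c * G n ({1..n} - {i}) r x
      - (c * G n {1..n} r y - c * G n ({1..n} - {i}) r y)
      = c * inverse (real n) * (g (r i) x - g (r i) y)"
    by (simp add: algebra_simps)
  also have "\<dots> \<le> c * inverse (real n) * (L (r i) * dist x y)"
    using c by (intro mult_left_mono convex_lipschitzD(3)[OF Li]) auto
  finally show "c * G n {1..n} r x - c * G n ({1..n} - {i}) r x
      - (c * G n {1..n} r y - c * G n ({1..n} - {i}) r y) \<le> c * L (r i) / real n * dist x y"
    by (simp add: divide_inverse mult_ac)
next
  show "convex_lipschitz (inverse (real n) * (\<Sum>j\<in>{1..n}. L (r j))) (G n {1..n} r)"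
    using r by (intro convex_lipschitz_G) auto
  show "convex_lipschitz (inverse (real n) * (\<Sum>j\<in>{1..n} - {i}. L (r j))) (G n ({1..n} - {i}) r)"
    using r by (intro convex_lipschitz_G) auto
qed

text \<open>A crude bound by the sum of both Lipschitz constants. It does not become small, but it
  provides an integrable majorant in \<open>leave_one_out_mean_zero\<close>.\<close>

lemma dist_prox_mean_le:
  assumes c: "0 < c" and A: "finite A" and r: "\<And>j. j \<in> A \<Longrightarrow> r j \<in> space \<mu>"
  shows "dist (rprox c (G n A r) z) (rprox c F z) \<le> c * (inverse (real n) * (\<Sum>j\<in>A. L (r j)) + M)"
proof (rule dist_prox_perturb_le[OF hadamard c c])
  define l where "l = inverse (real n) * (\<Sum>j\<in>A. L (r j))"
  have G: "convex_lipschitz l (G n A r)"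
    unfolding l_def by (rule convex_lipschitz_G[OF A r])
  then show "convex_lipschitz (inverse (real n) * (\<Sum>j\<in>A. L (r j))) (G n A r)"
    by (simp add: l_def)
  show "convex_lipschitz M F"
    by (rule convex_lipschitz_F)
  show "0 \<le> c * (inverse (real n) * (\<Sum>j\<in>A. L (r j)) + M)"
    using convex_lipschitzD(1)[OF G] M_nonneg c by (simp add: l_def)
  fix x y
  have "c * G n A r x - c * F x - (c * G n A r y - c * F y) = c * ((G n A r x - G n A r y) + (F y - F x))"
    by (simp add: algebra_simps)
  also have "\<dots> \<le> c * (l * dist x y + M * dist x y)"
    using c convex_lipschitzD(3)[OF G, of x y] convex_lipschitzD(3)[OF convex_lipschitz_F, of y x]
    by (intro mult_left_mono add_mono) (auto simp: dist_commute)
  finally show "c * G n A r x - c * F x - (c * G n A r y - c * F y)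
      \<le> c * (inverse (real n) * (\<Sum>j\<in>A. L (r j)) + M) * dist x y"
    by (simp add: l_def algebra_simps)
qed

lemma integrable_L_product:
  assumes "1 \<le> i" "1 \<le> j"
  shows "integrable P (\<lambda>\<omega>. L (\<xi> i \<omega>) * L (\<xi> j \<omega>))"
proof (rule Bochner_Integration.integrable_bound)
  note [measurable] = measurable_\<xi>[OF assms(1)] measurable_\<xi>[OF assms(2)]
  show "integrable P (\<lambda>\<omega>. (L (\<xi> i \<omega>))\<^sup>2 + (L (\<xi> j \<omega>))\<^sup>2)"
    using assms integrable_L2 by (intro Bochner_Integration.integrable_add integrable_sample)
  show "(\<lambda>\<omega>. L (\<xi> i \<omega>) * L (\<xi> j \<omega>)) \<in> borel_measurable P"
    by measurable
  have "\<bar>a * b\<bar> \<le> a\<^sup>2 + b\<^sup>2" for a b :: real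
    using sum_squares_bound[of "\<bar>a\<bar>" "\<bar>b\<bar>"] abs_ge_zero[of "a * b"]
    unfolding abs_mult power2_abs by linarith
  then show "AE \<omega> in P. norm (L (\<xi> i \<omega>) * L (\<xi> j \<omega>)) \<le> norm ((L (\<xi> i \<omega>))\<^sup>2 + (L (\<xi> j \<omega>))\<^sup>2)"
    by simp
qed

text \<open>The proximal point built from the other samples is independent of \<open>\<xi> i\<close>, so that
  \<open>g (\<xi> i)\<close> and \<open>F\<close> have the same mean there.\<close>

lemma leave_one_out_mean_zero:
  fixes z :: 'h
  assumes c: "0 < c" and i: "i \<in> {1..n}"
  defines "X \<equiv> \<lambda>r. rprox c (G n ({1..n} - {i}) r) z" and "p \<equiv> rprox c F z"
  defines "W \<equiv> \<lambda>\<omega>. (F (X (\<lambda>j. \<xi> j \<omega>)) - F p) - (g (\<xi> i \<omega>) (X (\<lambda>j. \<xi> j \<omega>)) - g (\<xi> i \<omega>) p)"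
  shows "integrable P W" "integral\<^sup>L P W = 0"
proof -
  define A where "A = {1..n} - {i}"
  define N where "N = PiM A (\<lambda>_. \<mu>)"
  \<comment> \<open>\<open>X\<close> reads only the samples in \<open>A\<close>, so it factors
    through their restriction, which takes values in the product space \<open>N\<close>.\<close>
  define R where "R \<omega> = restrict (\<lambda>j. \<xi> j \<omega>) A" for \<omega>
  define h where "h e r = (F (X r) - F p) - (g e (X r) - g e p)" for e r
  have A: "finite A" "A \<subseteq> {1..}" "i \<notin> A" "1 \<le> i"
    using i by (auto simp: A_def)
  have X_R: "X (R \<omega>) = X (\<lambda>j. \<xi> j \<omega>)" for \<omega>
    unfolding X_def R_def A_def G_def by simp
  have X_meas[measurable]: "X \<in> borel_measurable N"
    unfolding X_def A_def[symmetric]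
  proof (rule borel_measurable_rprox[OF hadamard c, where L = "\<lambda>r. inverse (real n) * (\<Sum>i\<in>A. L (r i))"])
    show "(\<lambda>r. G n A r x) \<in> borel_measurable N" for x
      unfolding G_def N_def by measurable
    show "convex_lipschitz (inverse (real n) * (\<Sum>i\<in>A. L (r i))) (G n A r)" if "r \<in> space N" for r
      using that A(1) by (intro convex_lipschitz_G) (auto simp: N_def space_PiM)
  qed
  have F_meas[measurable]: "F \<in> borel_measurable borel"
    by (intro borel_measurable_continuous_onI convex_lipschitz_continuous[OF convex_lipschitz_F])
  have gX_meas: "(\<lambda>q. g (fst q) (X (snd q))) \<in> borel_measurable (\<mu> \<Otimes>\<^sub>M N)"
  proof (rule borel_measurable_caratheodory[where G = "\<lambda>q. g (fst q)" and X = "\<lambda>q. X (snd q)"])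
    show "continuous_on UNIV (g (fst q))" if "q \<in> space (\<mu> \<Otimes>\<^sub>M N)" for q
      using that by (intro convex_lipschitz_continuous[OF convex_lipschitz_g]) (auto simp: space_pair_measure)
  qed measurable
  have h_meas[measurable]: "case_prod h \<in> borel_measurable (\<mu> \<Otimes>\<^sub>M N)"
    unfolding h_def[abs_def] split_beta' using gX_meas by measurable
  have \<xi>i[measurable]: "\<xi> i \<in> measurable P \<mu>"
    using measurable_\<xi> A by auto
  have R[measurable]: "R \<in> measurable P N"
    unfolding R_def N_def using measurable_\<xi> A(2) by (intro measurable_restrict) auto
  have W: "W = (\<lambda>\<omega>. case_prod h (\<xi> i \<omega>, R \<omega>))"
    by (simp add: W_def h_def X_R)
  \<comment> \<open>Expanded, the majorant contains only constants, single Lipschitz constants and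
    products of two of them, all integrable since \<open>L\<close> is square integrable.\<close>
  have bound: "\<bar>W \<omega>\<bar> \<le> (M + L (\<xi> i \<omega>)) * (c * (inverse (real n) * (\<Sum>j\<in>A. L (\<xi> j \<omega>)) + M))"
    if \<omega>: "\<omega> \<in> space P" for \<omega>
  proof -
    define x where "x = X (\<lambda>j. \<xi> j \<omega>)"
    have gi: "convex_lipschitz (L (\<xi> i \<omega>)) (g (\<xi> i \<omega>))"
      using convex_lipschitz_g \<xi>_space A \<omega> by blast
    have "\<bar>W \<omega>\<bar> \<le> M * dist x p + L (\<xi> i \<omega>) * dist x p"
      using convex_lipschitzD(2)[OF gi, of x p] convex_lipschitzD(2)[OF convex_lipschitz_F, of x p]
      unfolding W_def x_def[symmetric] by linarith
    also have "\<dots> = (M + L (\<xi> i \<omega>)) * dist x p"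
      by (simp add: algebra_simps)
    also have "\<dots> \<le> (M + L (\<xi> i \<omega>)) * (c * (inverse (real n) * (\<Sum>j\<in>A. L (\<xi> j \<omega>)) + M))"
      unfolding x_def X_def p_def A_def[symmetric]
      using M_nonneg convex_lipschitzD(1)[OF gi] \<xi>_space A \<omega>
      by (intro mult_left_mono dist_prox_mean_le[OF c]) auto
    finally show ?thesis .
  qed
  show int: "integrable P W"
  proof (rule Bochner_Integration.integrable_bound)
    have "integrable P (\<lambda>\<omega>. c * M * inverse (real n) * (\<Sum>j\<in>A. L (\<xi> j \<omega>)) + c * M * M
        + c * inverse (real n) * (\<Sum>j\<in>A. L (\<xi> i \<omega>) * L (\<xi> j \<omega>)) + c * M * L (\<xi> i \<omega>))"
      using A integrable_L by (intro Bochner_Integration.integrable_add integrable_mult_right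
          Bochner_Integration.integrable_sum integrable_L_product integrable_sample) auto
    then show "integrable P (\<lambda>\<omega>. (M + L (\<xi> i \<omega>)) * (c * (inverse (real n) * (\<Sum>j\<in>A. L (\<xi> j \<omega>)) + M)))"
      unfolding sum_distrib_left[symmetric] by (simp add: algebra_simps)
    show "W \<in> borel_measurable P"
      unfolding W by measurable
    show "AE \<omega> in P. norm (W \<omega>)
        \<le> norm ((M + L (\<xi> i \<omega>)) * (c * (inverse (real n) * (\<Sum>j\<in>A. L (\<xi> j \<omega>)) + M)))"
      using bound by (intro AE_I2) force
  qed
  \<comment> \<open>The single sample is packaged as the block \<open>{i}\<close>, so that
    independence of disjoint blocks of an independent family applies.\<close>
  define R' where "R' \<omega> = restrict (\<lambda>j. \<xi> j \<omega>) {i}" for \<omega>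
  define N' where "N' = PiM {i} (\<lambda>_. \<mu>)"
  define h' where "h' r' r = h (r' i) r" for r' r
  have R'[measurable]: "R' \<in> measurable P N'"
    unfolding R'_def N'_def using measurable_\<xi> A by (intro measurable_restrict) auto
  have proj[measurable]: "(\<lambda>r'. r' i) \<in> measurable N' \<mu>"
    unfolding N'_def by measurable
  have h'_meas[measurable]: "case_prod h' \<in> borel_measurable (N' \<Otimes>\<^sub>M N)"
    using measurable_compose[OF _ h_meas, of "\<lambda>q. (fst q i, snd q)" "N' \<Otimes>\<^sub>M N"]
    by (simp add: h'_def split_beta')
  have W': "W = (\<lambda>\<omega>. case_prod h' (R' \<omega>, R \<omega>))"
    by (simp add: W h'_def R'_def)
  have ind: "indep_var N' R' N R"
    unfolding N_def R_def N'_def R'_def using A by (intro indep_var_restrict[OF indep]) auto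
  define \<nu> where "\<nu> = distr P N R"
  define \<nu>' where "\<nu>' = distr P N' R'"
  have joint: "distr P (N' \<Otimes>\<^sub>M N) (\<lambda>\<omega>. (R' \<omega>, R \<omega>)) = \<nu>' \<Otimes>\<^sub>M \<nu>"
    using ind unfolding \<nu>_def \<nu>'_def by (simp add: indep_var_distribution_eq)
  interpret \<nu>: prob_space \<nu>
    unfolding \<nu>_def by (rule prob_space_distr[OF R])
  interpret \<nu>': prob_space \<nu>'
    unfolding \<nu>'_def by (rule prob_space_distr[OF R'])
  interpret Q: pair_prob_space \<nu>' \<nu> ..
  have "integrable (\<nu>' \<Otimes>\<^sub>M \<nu>) (case_prod h')"
    unfolding joint[symmetric] using int by (subst integrable_distr_eq) (auto simp: W')
  then have "(\<integral>r. (\<integral>r'. h' r' r \<partial>\<nu>') \<partial>\<nu>) = integral\<^sup>L (\<nu>' \<Otimes>\<^sub>M \<nu>) (case_prod h')"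
    by (rule Q.integral_snd)
  \<comment> \<open>With the other samples frozen, \<open>X r\<close> is a fixed point, at which
    \<open>g\<close> has mean \<open>F (X r)\<close>; the same holds at \<open>p\<close>.\<close>
  moreover have "(\<integral>r'. h' r' r \<partial>\<nu>') = 0" for r
  proof -
    have h_r[measurable]: "(\<lambda>e. h e r) \<in> borel_measurable \<mu>"
      unfolding h_def by measurable
    have "(\<integral>r'. h' r' r \<partial>\<nu>') = (\<integral>\<omega>. h (\<xi> i \<omega>) r \<partial>P)"
      unfolding \<nu>'_def h'_def by (subst integral_distr) (auto simp: R'_def)
    also have "\<dots> = (\<integral>e. h e r \<partial>\<mu>)"
      by (rule integral_sample[OF A(4) h_r])
    also have "\<dots> = 0"
      unfolding h_def using integrable_g by (simp add: F_def \<mu>.prob_space)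
    finally show ?thesis .
  qed
  moreover have "integral\<^sup>L (\<nu>' \<Otimes>\<^sub>M \<nu>) (case_prod h') = integral\<^sup>L P W"
    unfolding joint[symmetric] by (subst integral_distr) (auto simp: W')
  ultimately show "integral\<^sup>L P W = 0"
    by simp
qed

section \<open>Laws of large numbers along the squares\<close>

text \<open>The variational inequalities of the empirical point and of \<open>p\<close> bound their
  squared distance by a sample average of differences between \<open>F\<close> and
  \<open>g (\<xi> i)\<close>. Moving the \<open>i\<close>-th term to its leave-one-out point gives
  it mean zero, and the corrections have mean of order \<open>1 / n\<close>, which is summable along
  the squares.\<close>

lemma AE_prox_square_tendsto:
  assumes c: "0 < c"
  shows "AE \<omega> in P. (\<lambda>k. rprox c (G ((Suc k)\<^sup>2) {1..(Suc k)\<^sup>2} (\<lambda>j. \<xi> j \<omega>)) z) \<longlonglongrightarrow> rprox c F z"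
proof -
  define p where "p = rprox c F z"
  define X where "X n A \<omega> = rprox c (G n A (\<lambda>j. \<xi> j \<omega>)) z" for n A \<omega>
  define W where "W n i \<omega> = (F (X n ({1..n} - {i}) \<omega>) - F p)
    - (g (\<xi> i \<omega>) (X n ({1..n} - {i}) \<omega>) - g (\<xi> i \<omega>) p)" for n i \<omega>
  \<comment> \<open>\<open>V\<close> is the mean of the correction \<open>c M L + c L^2\<close> in
    \<open>Z\<close>, so that \<open>Z n\<close> has mean \<open>c V / n\<close>.\<close>
  define V where "V = c * M * M + c * (\<integral>e. (L e)\<^sup>2 \<partial>\<mu>)"
  define Z where "Z n \<omega> = c * inverse (real n) * (\<Sum>i\<in>{1..n}. W n i \<omega>
    + inverse (real n) * (c * M * L (\<xi> i \<omega>) + c * (L (\<xi> i \<omega>))\<^sup>2))" for n \<omega>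
  have le: "(dist (X n {1..n} \<omega>) p)\<^sup>2 \<le> Z n \<omega>" if n: "0 < n" and \<omega>: "\<omega> \<in> space P" for n \<omega>
  proof -
    define x where "x = X n {1..n} \<omega>"
    have \<xi>: "\<xi> i \<omega> \<in> space \<mu>" if "i \<in> {1..n}" for i
      using \<xi>_space \<omega> that by auto
    have Gn: "convex_lipschitz (inverse (real n) * (\<Sum>i\<in>{1..n}. L (\<xi> i \<omega>))) (G n {1..n} (\<lambda>j. \<xi> j \<omega>))"
      using \<xi> by (intro convex_lipschitz_G) auto
    have split: "G n {1..n} (\<lambda>j. \<xi> j \<omega>) y = inverse (real n) * (\<Sum>i\<in>{1..n}. g (\<xi> i \<omega>) y)" for y
      by (simp add: G_def)
    have "2 * c * G n {1..n} (\<lambda>j. \<xi> j \<omega>) x + (dist z x)\<^sup>2 + (dist x p)\<^sup>2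
        \<le> 2 * c * G n {1..n} (\<lambda>j. \<xi> j \<omega>) p + (dist z p)\<^sup>2"
      unfolding x_def X_def by (rule prox_variational_inequality[OF hadamard c Gn])
    moreover have "2 * c * F p + (dist z p)\<^sup>2 + (dist x p)\<^sup>2 \<le> 2 * c * F x + (dist z x)\<^sup>2"
      using prox_variational_inequality[OF hadamard c convex_lipschitz_F, of z x]
      unfolding p_def by (simp add: dist_commute)
    ultimately have "(dist x p)\<^sup>2 \<le> c * ((F x - F p)
        - (G n {1..n} (\<lambda>j. \<xi> j \<omega>) x - G n {1..n} (\<lambda>j. \<xi> j \<omega>) p))"
      by (simp add: algebra_simps)
    also have "\<dots> = c * inverse (real n) * (\<Sum>i\<in>{1..n}. (F x - F p) - (g (\<xi> i \<omega>) x - g (\<xi> i \<omega>) p))"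
      using n unfolding split sum_subtractf by (simp add: field_simps)
    also have "\<dots> \<le> Z n \<omega>"
      unfolding Z_def
    proof (intro mult_left_mono sum_mono)
      \<comment> \<open>Replacing \<open>x\<close> by the leave-one-out point \<open>y\<close> costs
        \<open>(M + l) * dist x y\<close>, and stability bounds \<open>dist x y\<close> by
        \<open>c l / n\<close>.\<close>
      fix i assume i: "i \<in> {1..n}"
      define l where "l = L (\<xi> i \<omega>)"
      define y where "y = X n ({1..n} - {i}) \<omega>"
      have gi: "convex_lipschitz l (g (\<xi> i \<omega>))"
        using convex_lipschitz_g \<xi>[OF i] by (simp add: l_def)
      have d: "dist x y \<le> c * l / real n"
        unfolding x_def y_def X_def l_def using \<xi> by (intro dist_prox_leave_one_out_le[OF c _ i]) auto
      have "F x - F y \<le> M * dist x y" "g (\<xi> i \<omega>) y - g (\<xi> i \<omega>) x \<le> l * dist x y"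
        using convex_lipschitzD(3)[OF convex_lipschitz_F, of x y] convex_lipschitzD(3)[OF gi, of y x]
        by (simp_all add: dist_commute)
      then have "(F x - F p) - (g (\<xi> i \<omega>) x - g (\<xi> i \<omega>) p) \<le> W n i \<omega> + (M + l) * dist x y"
        unfolding W_def y_def[symmetric] by (simp add: distrib_right)
      also have "\<dots> \<le> W n i \<omega> + (M + l) * (c * l / real n)"
        using d M_nonneg convex_lipschitzD(1)[OF gi] by (intro add_left_mono mult_left_mono) auto
      also have "(M + l) * (c * l / real n) = inverse (real n) * (c * M * l + c * l\<^sup>2)"
        by (simp add: divide_inverse power2_eq_square algebra_simps)
      finally show "(F x - F p) - (g (\<xi> i \<omega>) x - g (\<xi> i \<omega>) p) \<le> W n i \<omega>
          + inverse (real n) * (c * M * L (\<xi> i \<omega>) + c * (L (\<xi> i \<omega>))\<^sup>2)"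
        by (simp add: l_def)
    qed (use c in simp)
    finally show ?thesis
      by (simp add: x_def)
  qed
  have W: "integrable P (W n i)" "integral\<^sup>L P (W n i) = 0" if "i \<in> {1..n}" for n i
    using leave_one_out_mean_zero[OF c that, of z] unfolding W_def[abs_def] X_def p_def by simp_all
  have L: "integrable P (\<lambda>\<omega>. L (\<xi> i \<omega>))" "(\<integral>\<omega>. L (\<xi> i \<omega>) \<partial>P) = M"
    "integrable P (\<lambda>\<omega>. (L (\<xi> i \<omega>))\<^sup>2)" "(\<integral>\<omega>. (L (\<xi> i \<omega>))\<^sup>2 \<partial>P) = (\<integral>e. (L e)\<^sup>2 \<partial>\<mu>)" if "1 \<le> i" for i
    using integrable_sample[OF that integrable_L] integral_sample[OF that, of L]
      integrable_sample[OF that integrable_L2] integral_sample[OF that, of "\<lambda>e. (L e)\<^sup>2"]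
    by (simp_all add: M_def)
  have Z_int: "integrable P (Z n)" for n
    unfolding Z_def using W L
    by (intro integrable_mult_right Bochner_Integration.integrable_sum Bochner_Integration.integrable_add) auto
  have Z_integral: "integral\<^sup>L P (Z n) = c * V * inverse (real n)" for n
  proof -
    have "integral\<^sup>L P (Z n) = c * inverse (real n) * (\<Sum>i\<in>{1..n}. inverse (real n) * V)"
      unfolding Z_def V_def using W L by (simp add: Bochner_Integration.integral_sum)
    then show ?thesis
      by (cases "n = 0") simp_all
  qed
  have "AE \<omega> in P. (\<lambda>k. Z ((Suc k)\<^sup>2) \<omega>) \<longlonglongrightarrow> 0"
  proof (rule AE_tendsto_zero_of_summable_integral)
    show "0 \<le> Z ((Suc k)\<^sup>2) \<omega>" if "\<omega> \<in> space P" for k \<omega>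
      using le[of "(Suc k)\<^sup>2" \<omega>] that zero_le_power2[of "dist (X ((Suc k)\<^sup>2) {1..(Suc k)\<^sup>2} \<omega>) p"]
      by (meson order_trans zero_less_Suc zero_less_power)
    have "summable (\<lambda>k. inverse (real (Suc k) ^ 2))"
      using inverse_power_summable[of 2, where 'a = real] by (subst summable_Suc_iff) simp
    then show "summable (\<lambda>k. integral\<^sup>L P (Z ((Suc k)\<^sup>2)))"
      unfolding Z_integral by (intro summable_mult) simp
  qed (rule Z_int)
  then show ?thesis
  proof (rule AE_mp, intro AE_I2 impI)
    fix \<omega> assume \<omega>: "\<omega> \<in> space P" and lim: "(\<lambda>k. Z ((Suc k)\<^sup>2) \<omega>) \<longlonglongrightarrow> 0"
    have bound: "norm (dist (X ((Suc k)\<^sup>2) {1..(Suc k)\<^sup>2} \<omega>) p) \<le> sqrt (Z ((Suc k)\<^sup>2) \<omega>)" for k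
      using real_le_rsqrt[OF le[of "(Suc k)\<^sup>2" \<omega>]] \<omega> by simp
    have lim0: "(\<lambda>k. sqrt (Z ((Suc k)\<^sup>2) \<omega>)) \<longlonglongrightarrow> 0"
      using tendsto_real_sqrt[OF lim] by simp
    have "(\<lambda>k. dist (X ((Suc k)\<^sup>2) {1..(Suc k)\<^sup>2} \<omega>) p) \<longlonglongrightarrow> 0"
      by (rule Lim_null_comparison[OF always_eventually lim0]) (rule allI, rule bound)
    then show "(\<lambda>k. rprox c (G ((Suc k)\<^sup>2) {1..(Suc k)\<^sup>2} (\<lambda>j. \<xi> j \<omega>)) z) \<longlonglongrightarrow> rprox c F z"
      unfolding X_def p_def by (simp only: tendsto_dist_iff[symmetric])
  qed
qed

text \<open>By independence the off-diagonal covariances vanish, so the mean has variance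
  \<open>V / n\<close>, again summable along the squares.\<close>

lemma AE_mean_L_square_tendsto:
  "AE \<omega> in P. (\<lambda>k. inverse (real ((Suc k)\<^sup>2)) * (\<Sum>i=1..(Suc k)\<^sup>2. L (\<xi> i \<omega>))) \<longlonglongrightarrow> M"
proof -
  define Y where "Y i \<omega> = L (\<xi> i \<omega>) - M" for i \<omega>
  define V where "V = (\<integral>e. (L e - M)\<^sup>2 \<partial>\<mu>)"
  have LM: "integrable \<mu> (\<lambda>e. L e - M)" "(\<integral>e. L e - M \<partial>\<mu>) = 0"
    using integrable_L by (simp_all add: M_def \<mu>.prob_space)
  have LM2: "integrable \<mu> (\<lambda>e. (L e - M)\<^sup>2)"
    unfolding power2_diff using integrable_L integrable_L2 by (auto simp: mult.assoc intro!: integrable_mult_right)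
  have Y: "integrable P (Y i)" "integral\<^sup>L P (Y i) = 0"
    "integrable P (\<lambda>\<omega>. Y i \<omega> * Y i \<omega>)" "(\<integral>\<omega>. Y i \<omega> * Y i \<omega> \<partial>P) = V" if "1 \<le> i" for i
    using integrable_sample[OF that LM(1)] integral_sample[OF that, of "\<lambda>e. L e - M"] LM
      integrable_sample[OF that LM2] integral_sample[OF that, of "\<lambda>e. (L e - M)\<^sup>2"]
    unfolding Y_def V_def by (simp_all add: power2_eq_square)
  have indY: "indep_vars (\<lambda>_. borel) Y {1..}"
    unfolding Y_def by (rule indep_vars_compose2[OF indep]) measurable
  have ind: "indep_vars (\<lambda>_. borel) Y {i, j}" if "1 \<le> i" "1 \<le> j" for i j
    by (rule indep_vars_subset[OF indY]) (use that in auto)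
  have cross: "integrable P (\<lambda>\<omega>. Y i \<omega> * Y j \<omega>)" "(\<integral>\<omega>. Y i \<omega> * Y j \<omega> \<partial>P) = (if i = j then V else 0)"
    if ij: "1 \<le> i" "1 \<le> j" for i j
  proof -
    have "integrable P (\<lambda>\<omega>. Y i \<omega> * Y j \<omega>)" "(\<integral>\<omega>. Y i \<omega> * Y j \<omega> \<partial>P) = 0" if "i \<noteq> j"
      using indep_vars_integrable[OF _ ind[OF ij]] indep_vars_lebesgue_integral[OF _ ind[OF ij]] Y ij that
      by auto
    then show "integrable P (\<lambda>\<omega>. Y i \<omega> * Y j \<omega>)" "(\<integral>\<omega>. Y i \<omega> * Y j \<omega> \<partial>P) = (if i = j then V else 0)"
      using Y ij by (cases "i = j"; simp)+
  qed
  define Z where "Z n \<omega> = (inverse (real n) * (\<Sum>i=1..n. Y i \<omega>))\<^sup>2" for n \<omega>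
  have Z: "Z n \<omega> = (inverse (real n))\<^sup>2 * (\<Sum>i=1..n. \<Sum>j=1..n. Y i \<omega> * Y j \<omega>)" for n \<omega>
    unfolding Z_def power_mult_distrib by (simp add: power2_eq_square sum_product)
  have Z_int: "integrable P (Z n)" for n
    unfolding Z[abs_def] using cross
    by (intro integrable_mult_right Bochner_Integration.integrable_sum) auto
  have Z_integral: "integral\<^sup>L P (Z n) = V * inverse (real n)" for n
  proof -
    have "(\<integral>\<omega>. (\<Sum>i=1..n. \<Sum>j=1..n. Y i \<omega> * Y j \<omega>) \<partial>P) = (\<Sum>i=1..n. \<integral>\<omega>. (\<Sum>j=1..n. Y i \<omega> * Y j \<omega>) \<partial>P)"
      using cross by (intro Bochner_Integration.integral_sum Bochner_Integration.integrable_sum) auto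
    also have "\<dots> = (\<Sum>i=1..n. \<Sum>j=1..n. \<integral>\<omega>. Y i \<omega> * Y j \<omega> \<partial>P)"
      using cross by (intro sum.cong Bochner_Integration.integral_sum) auto
    also have "\<dots> = (\<Sum>i=1..n. \<Sum>j=1..n. if i = j then V else 0)"
      using cross by (intro sum.cong) auto
    also have "\<dots> = real n * V"
      by simp
    finally have "integral\<^sup>L P (Z n) = (inverse (real n))\<^sup>2 * (real n * V)"
      unfolding Z[abs_def] by (simp only: integral_mult_right_zero)
    then show ?thesis
      by (cases "n = 0") (simp_all add: power2_eq_square)
  qed
  have "AE \<omega> in P. (\<lambda>k. Z ((Suc k)\<^sup>2) \<omega>) \<longlonglongrightarrow> 0"
  proof (rule AE_tendsto_zero_of_summable_integral)
    have "summable (\<lambda>k. inverse (real (Suc k) ^ 2))"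
      using inverse_power_summable[of 2, where 'a = real] by (subst summable_Suc_iff) simp
    then show "summable (\<lambda>k. integral\<^sup>L P (Z ((Suc k)\<^sup>2)))"
      unfolding Z_integral by (intro summable_mult) simp
  qed (rule Z_int, simp add: Z_def)
  then show ?thesis
  proof (rule AE_mp, intro AE_I2 impI)
    fix \<omega> assume \<omega>: "\<omega> \<in> space P" and lim: "(\<lambda>k. Z ((Suc k)\<^sup>2) \<omega>) \<longlonglongrightarrow> 0"
    have "inverse (real n) * (\<Sum>i=1..n. Y i \<omega>) = inverse (real n) * (\<Sum>i=1..n. L (\<xi> i \<omega>)) - M" if "0 < n" for n
      using that by (simp add: Y_def sum_subtractf algebra_simps)
    then have "sqrt (Z ((Suc k)\<^sup>2) \<omega>)
        = \<bar>inverse (real ((Suc k)\<^sup>2)) * (\<Sum>i=1..(Suc k)\<^sup>2. L (\<xi> i \<omega>)) - M\<bar>" for k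
      by (simp only: Z_def real_sqrt_abs zero_less_power zero_less_Suc)
    then have "(\<lambda>k. \<bar>inverse (real ((Suc k)\<^sup>2)) * (\<Sum>i=1..(Suc k)\<^sup>2. L (\<xi> i \<omega>)) - M\<bar>) \<longlonglongrightarrow> 0"
      using tendsto_real_sqrt[OF lim] by simp
    then show "(\<lambda>k. inverse (real ((Suc k)\<^sup>2)) * (\<Sum>i=1..(Suc k)\<^sup>2. L (\<xi> i \<omega>))) \<longlonglongrightarrow> M"
      by (simp only: tendsto_rabs_zero_iff LIM_zero_iff)
  qed
qed

section \<open>From square sample sizes to all sample sizes\<close>

lemma sum_L_mono:
  assumes "\<omega> \<in> space P" "m \<le> n"
  shows "(\<Sum>i=1..m. L (\<xi> i \<omega>)) \<le> (\<Sum>i=1..n. L (\<xi> i \<omega>))"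
  using assms L_nonneg \<xi>_space by (intro sum_mono2) auto

text \<open>In the difference of the means the first \<open>m\<close> samples carry weight
  \<open>1/m - 1/n\<close> in absolute value and the later ones \<open>1/n\<close>; weighting the
  Lipschitz constants accordingly gives the bound. It tends to 0 when \<open>n / m\<close> tends to
  1 and the mean Lipschitz constants converge.\<close>

lemma dist_prox_mean_mean_le:
  assumes c: "0 < c" and \<omega>: "\<omega> \<in> space P" and m: "0 < m" "m \<le> n"
  defines "S \<equiv> \<lambda>n. \<Sum>i=1..n. L (\<xi> i \<omega>)"
  shows "dist (rprox c (G n {1..n} (\<lambda>j. \<xi> j \<omega>)) z) (rprox c (G m {1..m} (\<lambda>j. \<xi> j \<omega>)) z)
    \<le> c * (S n / real n + S m / real m - 2 * (S m / real n))"
proof (rule dist_prox_perturb_le[OF hadamard c c])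
  have \<xi>: "\<xi> i \<omega> \<in> space \<mu>" if "1 \<le> i" for i
    using \<xi>_space \<omega> that by auto
  show "convex_lipschitz (inverse (real n) * (\<Sum>i\<in>{1..n}. L (\<xi> i \<omega>))) (G n {1..n} (\<lambda>j. \<xi> j \<omega>))"
    using \<xi> by (intro convex_lipschitz_G) auto
  show "convex_lipschitz (inverse (real m) * (\<Sum>i\<in>{1..m}. L (\<xi> i \<omega>))) (G m {1..m} (\<lambda>j. \<xi> j \<omega>))"
    using \<xi> by (intro convex_lipschitz_G) auto
  have E: "S n / real n + S m / real m - 2 * (S m / real n)
      = inverse (real n) * (S n - S m) + (inverse (real m) - inverse (real n)) * S m"
    by (simp add: divide_inverse algebra_simps)
  have inv: "inverse (real n) \<le> inverse (real m)"
    using m by (intro le_imp_inverse_le) auto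
  have "0 \<le> S m"
    unfolding S_def using L_nonneg \<xi> by (intro sum_nonneg) auto
  moreover have "S m \<le> S n"
    unfolding S_def by (rule sum_L_mono[OF \<omega> m(2)])
  ultimately show "0 \<le> c * (S n / real n + S m / real m - 2 * (S m / real n))"
    unfolding E using c inv by (intro mult_nonneg_nonneg add_nonneg_nonneg) auto
  fix x y
  define D where "D i = g (\<xi> i \<omega>) x - g (\<xi> i \<omega>) y" for i
  define T where "T n = (\<Sum>i=1..n. D i)" for n
  have D: "\<bar>D i\<bar> \<le> L (\<xi> i \<omega>) * dist x y" if "1 \<le> i" for i
    unfolding D_def using convex_lipschitz_g[OF \<xi>[OF that]] by (rule convex_lipschitzD)
  have split: "(\<Sum>i=1..n. h i) = (\<Sum>i=1..m. h i) + (\<Sum>i\<in>{Suc m..n}. h i)" for h :: "nat \<Rightarrow> real"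
    using m sum.ub_add_nat[of 1 m h "n - m"] by simp
  have "T n - T m = (\<Sum>i\<in>{Suc m..n}. D i)"
    unfolding T_def using split[of D] by simp
  also have "\<dots> \<le> (\<Sum>i\<in>{Suc m..n}. L (\<xi> i \<omega>) * dist x y)"
    using D by (intro sum_mono) (force simp: abs_le_iff)
  also have "\<dots> = (S n - S m) * dist x y"
    unfolding S_def using split[of "\<lambda>i. L (\<xi> i \<omega>)"] by (simp add: sum_distrib_right)
  finally have 1: "T n - T m \<le> (S n - S m) * dist x y" .
  have "- T m \<le> (\<Sum>i=1..m. L (\<xi> i \<omega>) * dist x y)"
    unfolding T_def sum_negf[symmetric] using D by (intro sum_mono) (force simp: abs_le_iff)
  then have 2: "- T m \<le> S m * dist x y"
    unfolding S_def by (simp add: sum_distrib_right)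
  have "c * G n {1..n} (\<lambda>j. \<xi> j \<omega>) x - c * G m {1..m} (\<lambda>j. \<xi> j \<omega>) x
      - (c * G n {1..n} (\<lambda>j. \<xi> j \<omega>) y - c * G m {1..m} (\<lambda>j. \<xi> j \<omega>) y)
      = c * (inverse (real n) * T n - inverse (real m) * T m)"
    unfolding G_def T_def D_def sum_subtractf by (simp add: algebra_simps)
  also have "\<dots> = c * (inverse (real n) * (T n - T m) + (inverse (real m) - inverse (real n)) * (- T m))"
    by (simp add: algebra_simps)
  also have "\<dots> \<le> c * (inverse (real n) * ((S n - S m) * dist x y)
      + (inverse (real m) - inverse (real n)) * (S m * dist x y))"
    using c inv 1 2 by (intro mult_left_mono add_mono) auto
  finally show "c * G n {1..n} (\<lambda>j. \<xi> j \<omega>) x - c * G m {1..m} (\<lambda>j. \<xi> j \<omega>) x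
      - (c * G n {1..n} (\<lambda>j. \<xi> j \<omega>) y - c * G m {1..m} (\<lambda>j. \<xi> j \<omega>) y)
      \<le> c * (S n / real n + S m / real m - 2 * (S m / real n)) * dist x y"
    unfolding E by (simp add: algebra_simps)
qed

text \<open>The partial sums increase, so \<open>S n\<close> is at most its value at the next square
  \<open>(k + 1)^2\<close>, with \<open>k\<close> the integer square root of \<open>n\<close>. The
  factor 4 comes from \<open>(k + 1)^2 \<le> 4 k^2 \<le> 4 n\<close>.\<close>

lemma mean_L_bounded:
  assumes \<omega>: "\<omega> \<in> space P"
    and lim: "(\<lambda>k. inverse (real ((Suc k)\<^sup>2)) * (\<Sum>i=1..(Suc k)\<^sup>2. L (\<xi> i \<omega>))) \<longlonglongrightarrow> l"
  shows "\<exists>B. \<forall>n. (\<Sum>i=1..n. L (\<xi> i \<omega>)) \<le> real n * B"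
proof -
  define S where "S n = (\<Sum>i=1..n. L (\<xi> i \<omega>))" for n
  have "Bseq (\<lambda>k. inverse (real ((Suc k)\<^sup>2)) * S ((Suc k)\<^sup>2))"
    using lim unfolding S_def by (intro convergent_imp_Bseq convergentI)
  then obtain K where K: "0 < K" "\<And>k. norm (inverse (real ((Suc k)\<^sup>2)) * S ((Suc k)\<^sup>2)) \<le> K"
    by (auto elim: BseqE)
  have "S n \<le> real n * (4 * K)" for n
  proof (cases "n = 0")
    case False
    define k where "k = floor_sqrt n"
    have k: "0 < k" "k\<^sup>2 \<le> n" "n \<le> (Suc k)\<^sup>2"
      using False Suc_floor_sqrt_power2_gt[of n] by (auto simp: k_def intro: less_imp_le)
    have "S n \<le> S ((Suc k)\<^sup>2)"
      unfolding S_def using k by (intro sum_L_mono[OF \<omega>])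
    also have "\<dots> \<le> K * real ((Suc k)\<^sup>2)"
      using K(2)[of k] by (simp add: field_simps abs_le_iff)
    also have "\<dots> \<le> K * real (4 * k\<^sup>2)"
    proof (intro mult_left_mono of_nat_mono)
      show "(Suc k)\<^sup>2 \<le> 4 * k\<^sup>2"
        using power_mono[of "Suc k" "2 * k" 2] k(1) by (simp add: power_mult_distrib)
    qed (use K(1) in simp)
    also have "\<dots> \<le> K * real (4 * n)"
      using K(1) k(2) by (intro mult_left_mono of_nat_mono) auto
    finally show ?thesis
      by (simp add: mult_ac)
  qed (simp add: S_def)
  then show ?thesis
    unfolding S_def by blast
qed

text \<open>Between consecutive squares, \<open>n\<close> and \<open>S n\<close> are replaced by
  endpoint values that enlarge the perturbation bound. The ratio \<open>q\<close> of the squares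
  tends to 1, so the bound tends to \<open>c (l + l - 2 l) = 0\<close>.\<close>

lemma prox_mean_tendsto_of_squares:
  assumes c: "0 < c" and \<omega>: "\<omega> \<in> space P"
    and lim: "(\<lambda>k. inverse (real ((Suc k)\<^sup>2)) * (\<Sum>i=1..(Suc k)\<^sup>2. L (\<xi> i \<omega>))) \<longlonglongrightarrow> l"
    and conv: "(\<lambda>k. rprox c (G ((Suc k)\<^sup>2) {1..(Suc k)\<^sup>2} (\<lambda>j. \<xi> j \<omega>)) z) \<longlonglongrightarrow> p"
  shows "(\<lambda>n. rprox c (G n {1..n} (\<lambda>j. \<xi> j \<omega>)) z) \<longlonglongrightarrow> p"
proof -
  define S where "S n = (\<Sum>i=1..n. L (\<xi> i \<omega>))" for n
  define X where "X n = rprox c (G n {1..n} (\<lambda>j. \<xi> j \<omega>)) z" for n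
  define b where "b k = inverse (real ((Suc k)\<^sup>2)) * S ((Suc k)\<^sup>2)" for k
  define q where "q k = (real (Suc (Suc k)) / real (Suc k))\<^sup>2" for k
  define E where "E k = c * (b (Suc k) * q k + b k - 2 * (b k / q k)) + dist (X ((Suc k)\<^sup>2)) p" for k
  have b: "b \<longlonglongrightarrow> l"
    using lim unfolding b_def[abs_def] S_def .
  have "q \<longlonglongrightarrow> 1\<^sup>2"
    unfolding q_def[abs_def] by (intro tendsto_power LIMSEQ_Suc[OF LIMSEQ_Suc_n_over_n])
  then have q: "q \<longlonglongrightarrow> 1"
    by simp
  have conv0: "(\<lambda>k. dist (X ((Suc k)\<^sup>2)) p) \<longlonglongrightarrow> 0"
    using conv unfolding X_def by (simp only: tendsto_dist_iff[symmetric])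
  have "E \<longlonglongrightarrow> c * (l * 1 + l - 2 * (l / 1)) + 0"
    unfolding E_def[abs_def] by (intro tendsto_intros b q LIMSEQ_Suc[OF b] conv0) auto
  then have E: "E \<longlonglongrightarrow> 0"
    by simp
  \<comment> \<open>The squares are indexed as \<open>(Suc k)^2\<close>, hence the shift by
    one.\<close>
  have "filterlim (\<lambda>n. floor_sqrt n - 1) at_top sequentially"
    unfolding filterlim_at_top
  proof
    fix K
    show "\<forall>\<^sub>F n in sequentially. K \<le> floor_sqrt n - 1"
      using eventually_ge_at_top[of "(Suc K)\<^sup>2"]
    proof eventually_elim
      case (elim n)
      then have "Suc K \<le> floor_sqrt n"
        by (simp add: le_floor_sqrt_iff)
      then show ?case
        by simp
    qed
  qed
  then have lim0: "(\<lambda>n. E (floor_sqrt n - 1)) \<longlonglongrightarrow> 0"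
    by (rule filterlim_compose[OF E])
  have "\<forall>\<^sub>F n in sequentially. norm (dist (X n) p) \<le> E (floor_sqrt n - 1)"
    using eventually_gt_at_top[of 0]
  proof eventually_elim
    case (elim n)
    define k where "k = floor_sqrt n - 1"
    have Sk: "Suc k = floor_sqrt n"
      using elim unfolding k_def by simp
    have n: "(Suc k)\<^sup>2 \<le> n" "n \<le> (Suc (Suc k))\<^sup>2"
      using Suc_floor_sqrt_power2_gt[of n] unfolding Sk by (auto intro: less_imp_le)
    have rn: "real ((Suc k)\<^sup>2) \<le> real n"
      using n by (simp only: of_nat_le_iff)
    have S0: "0 \<le> S m" for m
      unfolding S_def using L_nonneg \<xi>_space \<omega> by (intro sum_nonneg) auto
    have S_le: "S n \<le> S ((Suc (Suc k))\<^sup>2)"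
      unfolding S_def by (rule sum_L_mono[OF \<omega> n(2)])
    have "dist (X n) (X ((Suc k)\<^sup>2)) \<le> c * (S n / real n
        + S ((Suc k)\<^sup>2) / real ((Suc k)\<^sup>2) - 2 * (S ((Suc k)\<^sup>2) / real n))"
      unfolding X_def S_def using n by (intro dist_prox_mean_mean_le[OF c \<omega>]) auto
    also have "\<dots> \<le> c * (b (Suc k) * q k + b k - 2 * (b k / q k))"
    proof (intro mult_left_mono diff_mono add_mono)
      have "S n / real n \<le> S ((Suc (Suc k))\<^sup>2) / real ((Suc k)\<^sup>2)"
        by (rule frac_le[OF S0 S_le _ rn]) simp
      also have "\<dots> = b (Suc k) * q k"
        by (simp add: b_def q_def power_divide inverse_eq_divide del: of_nat_Suc)
      finally show "S n / real n \<le> b (Suc k) * q k" .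
      show "S ((Suc k)\<^sup>2) / real ((Suc k)\<^sup>2) \<le> b k"
        by (simp add: b_def divide_inverse mult.commute)
      have "b k / q k = S ((Suc k)\<^sup>2) / real ((Suc (Suc k))\<^sup>2)"
        by (simp add: b_def q_def power_divide inverse_eq_divide del: of_nat_Suc)
      also have "\<dots> \<le> S ((Suc k)\<^sup>2) / real n"
        using n elim S0 by (intro divide_left_mono) (auto simp del: of_nat_power)
      finally show "b k / q k \<le> S ((Suc k)\<^sup>2) / real n" .
    qed (use c in simp_all)
    finally have "dist (X n) (X ((Suc k)\<^sup>2)) \<le> c * (b (Suc k) * q k + b k - 2 * (b k / q k))" .
    then show ?case
      using dist_triangle[of "X n" p "X ((Suc k)\<^sup>2)"] unfolding k_def[symmetric] E_def by simp
  qed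
  then have "(\<lambda>n. dist (X n) p) \<longlonglongrightarrow> 0"
    using lim0 by (rule Lim_null_comparison)
  then show ?thesis
    unfolding X_def by (simp only: tendsto_dist_iff[symmetric])
qed

text \<open>Null sets are discarded only for rational steps and dense centres. For a fixed remaining
  \<open>\<omega>\<close> the passage from squares to all \<open>n\<close>, and then to all
  \<open>c\<close> and \<open>z\<close>, is deterministic, so the exceptional set depends on
  neither.\<close>

lemma AE_prox_mean_tendsto:
  "AE \<omega> in P. (\<exists>B. \<forall>n. (\<Sum>i=1..n. L (\<xi> i \<omega>)) \<le> real n * B) \<and>
     (\<forall>c>0. \<forall>z. (\<lambda>n. rprox c (G n {1..n} (\<lambda>j. \<xi> j \<omega>)) z) \<longlonglongrightarrow> rprox c F z)"
proof -
  obtain d :: "nat \<Rightarrow> 'h" where d: "\<And>X. open X \<Longrightarrow> X \<noteq> {} \<Longrightarrow> \<exists>i. d i \<in> X"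
    using countable_dense_seq by blast
  have "AE \<omega> in P. \<forall>q\<in>\<rat> \<inter> {0<..}. \<forall>i.
      (\<lambda>k. rprox q (G ((Suc k)\<^sup>2) {1..(Suc k)\<^sup>2} (\<lambda>j. \<xi> j \<omega>)) (d i)) \<longlonglongrightarrow> rprox q F (d i)"
    by (intro AE_ball_countable' AE_all_countable[THEN iffD2] allI AE_prox_square_tendsto)
      (auto intro: countable_subset[OF _ countable_rat])
  then show ?thesis
    using AE_mean_L_square_tendsto AE_space
  proof eventually_elim
    case (elim \<omega>)
    let ?G = "\<lambda>n. G n {1..n} (\<lambda>j. \<xi> j \<omega>)"
    obtain B where B: "\<And>n. (\<Sum>i=1..n. L (\<xi> i \<omega>)) \<le> real n * B"
      using mean_L_bounded[OF elim(3,2)] by blast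
    \<comment> \<open>The bound \<open>B\<close> depends on \<open>\<omega>\<close>;
      \<open>max B M\<close> serves both the means and \<open>F\<close>, and its nonnegativity
      covers \<open>n = 0\<close>.\<close>
    have G': "convex_lipschitz (max B M) (?G n)" for n
    proof (rule convex_lipschitz_mono)
      show "convex_lipschitz (inverse (real n) * (\<Sum>i\<in>{1..n}. L (\<xi> i \<omega>))) (?G n)"
        using \<xi>_space elim(3) by (intro convex_lipschitz_G) auto
      have "(\<Sum>i\<in>{1..n}. L (\<xi> i \<omega>)) \<le> real n * max B M"
        using B[of n] by (rule order_trans) (simp add: mult_left_mono)
      then show "inverse (real n) * (\<Sum>i\<in>{1..n}. L (\<xi> i \<omega>)) \<le> max B M"
        using M_nonneg by (cases "n = 0") (simp_all add: field_simps)
    qed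
    have F': "convex_lipschitz (max B M) F"
      by (rule convex_lipschitz_mono[OF convex_lipschitz_F]) simp
    have lim: "(\<lambda>n. rprox q (?G n) (d i)) \<longlonglongrightarrow> rprox q F (d i)" if "q \<in> \<rat>" "0 < q" for q i
      using elim(1) that by (intro prox_mean_tendsto_of_squares[OF that(2) elim(3,2)]) auto
    have "(\<lambda>n. rprox c (?G n) z) \<longlonglongrightarrow> rprox c F z" if "0 < c" for c z
      by (rule prox_tendsto_of_dense[OF hadamard G' F' lim d that])
    then show ?case
      using B by blast
  qed
qed

lemma AE_prox_product_tendsto_gradient_flow:
  "AE \<omega> in P. \<forall>t>0. \<forall>x. (\<lambda>n. (prox_product (\<lambda>i y. ereal (g (\<xi> i \<omega>) y)) (t / (real n)\<^sup>2) n ^^ n) x)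
    \<longlonglongrightarrow> gradient_flow (\<lambda>y. ereal (F y)) t x"
  using AE_prox_mean_tendsto AE_space
proof eventually_elim
  case (elim \<omega>)
  then obtain B where B: "\<And>n. (\<Sum>i=1..n. L (\<xi> i \<omega>)) \<le> real n * B"
    by blast
  show ?case
  proof (intro allI impI)
    fix t :: real and x :: 'h assume t: "0 < t"
    show "(\<lambda>n. (prox_product (\<lambda>i y. ereal (g (\<xi> i \<omega>) y)) (t / (real n)\<^sup>2) n ^^ n) x)
      \<longlonglongrightarrow> gradient_flow (\<lambda>y. ereal (F y)) t x"
    proof (rule prox_product_tendsto_gradient_flow[OF hadamard t])
      show "convex_lipschitz (L (\<xi> i \<omega>)) (g (\<xi> i \<omega>))" if "1 \<le> i" for i
        using convex_lipschitz_g \<xi>_space elim(2) that by blast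
      show "convex_lipschitz (max B M) F"
        by (rule convex_lipschitz_mono[OF convex_lipschitz_F]) simp
      show "(\<Sum>i=1..n. L (\<xi> i \<omega>)) \<le> real n * max B M" for n
        using B[of n] by (rule order_trans) (simp add: mult_left_mono)
      show "(\<lambda>n. rprox c (\<lambda>y. inverse (real n) * (\<Sum>i=1..n. g (\<xi> i \<omega>) y)) z) \<longlonglongrightarrow> rprox c F z"
        if "0 < c" for c z
        using elim(1) that by (simp add: G_def)
    qed
  qed
qed

end

section \<open>Reduction to real-valued integrands\<close>

lemma ereal_integral_eq_integral:
  fixes h :: "'a \<Rightarrow> real"
  assumes h: "integrable M h" and \<phi>: "\<And>x. x \<in> space M \<Longrightarrow> \<phi> x = ereal (h x)"
  shows "ereal_integral M \<phi> = ereal (integral\<^sup>L M h)"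
proof -
  obtain r q where rq: "0 \<le> r" "0 \<le> q" "(\<integral>\<^sup>+x. ennreal (h x) \<partial>M) = ennreal r"
    "(\<integral>\<^sup>+x. ennreal (- h x) \<partial>M) = ennreal q" "integral\<^sup>L M h = r - q"
    using integrableE[OF h] by metis
  have "(\<integral>\<^sup>+x. e2ennreal (\<phi> x) \<partial>M) = ennreal r" "(\<integral>\<^sup>+x. e2ennreal (- \<phi> x) \<partial>M) = ennreal q"
    using \<phi> unfolding rq(3,4)[symmetric] by (auto intro!: nn_integral_cong)
  then show ?thesis
    using rq by (simp add: ereal_integral_def)
qed

text \<open>\<open>L2_map\<close> speaks of one reference point; the triangle inequality and the
  finiteness of the measure carry the property to every other.\<close>

lemma (in finite_measure) L2_map_integrable_dist:
  assumes "L2_map M u"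
  shows "integrable M (\<lambda>e. (dist (u e) x)\<^sup>2)"
proof -
  obtain z where z: "integrable M (\<lambda>e. (dist (u e) z)\<^sup>2)" and [measurable]: "u \<in> borel_measurable M"
    using assms unfolding L2_map_def by blast
  show ?thesis
  proof (rule Bochner_Integration.integrable_bound)
    show "integrable M (\<lambda>e. 2 * (dist (u e) z)\<^sup>2 + 2 * (dist z x)\<^sup>2)"
      using z by simp
    have "(\<lambda>y. dist y x) \<in> borel_measurable borel"
      by (intro borel_measurable_continuous_onI continuous_intros)
    then have "(\<lambda>e. dist (u e) x) \<in> borel_measurable M"
      by (rule measurable_compose[rotated]) measurable
    then show "(\<lambda>e. (dist (u e) x)\<^sup>2) \<in> borel_measurable M"
      by (rule borel_measurable_power)
    have "(dist (u e) x)\<^sup>2 \<le> 2 * (dist (u e) z)\<^sup>2 + 2 * (dist z x)\<^sup>2" for e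
    proof -
      have "(dist (u e) x)\<^sup>2 \<le> (dist (u e) z + dist z x)\<^sup>2"
        by (intro power_mono dist_triangle) simp
      also have "\<dots> \<le> 2 * (dist (u e) z)\<^sup>2 + 2 * (dist z x)\<^sup>2"
        using sum_squares_bound[of "dist (u e) z" "dist z x"] by (simp add: power2_sum)
      finally show ?thesis .
    qed
    then show "AE e in M. norm ((dist (u e) x)\<^sup>2) \<le> norm (2 * (dist (u e) z)\<^sup>2 + 2 * (dist z x)\<^sup>2)"
      by (intro AE_I2) simp
  qed
qed

text \<open>The singleton \<open>{(x, a)}\<close> is closed, and the epigraph of \<open>f e\<close>
  meets it exactly when \<open>g e x \<le> a\<close>.\<close>

lemma normal_integrand_measurable:
  assumes f: "normal_integrand \<mu> f"
    and g: "\<And>e x. e \<in> space \<mu> \<Longrightarrow> f e x = ereal (g e x)"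
  shows "(\<lambda>e. g e x) \<in> borel_measurable \<mu>"
  unfolding borel_measurable_iff_le
proof
  fix a
  have "{e \<in> space \<mu>. \<exists>(y, \<alpha>)\<in>{(x, a)}. f e y \<le> ereal \<alpha>} \<in> sets \<mu>"
    using f unfolding normal_integrand_def by blast
  also have "{e \<in> space \<mu>. \<exists>(y, \<alpha>)\<in>{(x, a)}. f e y \<le> ereal \<alpha>} = {e \<in> space \<mu>. g e x \<le> a}"
    using g by auto
  finally show "{e \<in> space \<mu>. g e x \<le> a} \<in> sets \<mu>" .
qed

text \<open>An infinite value beside a finite one would make the difference infinite, against the
  real Lipschitz bound.\<close>

lemma proper_lipschitz_finite:
  fixes h :: "'h::metric_space \<Rightarrow> ereal"
  assumes "proper_fun h" and lip: "\<And>x y. \<bar>h x - h y\<bar> \<le> ereal (K * dist x y)"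
  shows "h x = ereal (real_of_ereal (h x))"
proof -
  obtain y where "h y \<noteq> \<infinity>" "h y \<noteq> -\<infinity>" "h x \<noteq> -\<infinity>"
    using assms(1) unfolding proper_fun_def by blast
  then show ?thesis
    using lip[of x y] by (cases "h x"; cases "h y") auto
qed

theorem theorem7p5:
  fixes P :: "'w measure" and \<mu> :: "'e measure"
    and \<xi> :: "nat \<Rightarrow> 'w \<Rightarrow> 'e"
    and f :: "'e \<Rightarrow> 'h::polish_space \<Rightarrow> ereal"
    and u\<^sub>0 :: "'e \<Rightarrow> 'h"
  assumes "prob_space P"
    and "prob_space \<mu>" and "complete_measure \<mu>" and "separable_measure \<mu>"
    and "full_hilbert_hadamard_space TYPE('h)"
    and "prob_space.indep_vars P (\<lambda>_. \<mu>) \<xi> {1..}"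
    and "\<And>i. 1 \<le> i \<Longrightarrow> distr P \<mu> (\<xi> i) = \<mu>"
    and "normal_convex_integrand \<mu> f" and "proper_integrand \<mu> f"
    and "L2_Lipschitz \<mu> f"
    and "L2_map \<mu> u\<^sub>0" and "L1_ereal \<mu> (\<lambda>e. f e (u\<^sub>0 e))"
  shows "(\<exists>\<Omega>'. \<Omega>' \<in> sets P \<and> measure P \<Omega>' = 1 \<and>
      (\<forall>\<omega>\<in>\<Omega>'. \<forall>t\<ge>0. \<forall>x.
        (\<lambda>n. (prox_product (\<lambda>i. f (\<xi> i \<omega>)) (t / (real n)\<^sup>2) n ^^ n) x)
          \<longlonglongrightarrow> gradient_flow (\<lambda>y. ereal_integral \<mu> (\<lambda>e. f e y)) t x))
    \<and> (\<forall>t\<ge>0. \<forall>x. AE \<omega> in P.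
        (\<lambda>n. (prox_product (\<lambda>i. f (\<xi> i \<omega>)) (t / (real n)\<^sup>2) n ^^ n) x)
          \<longlonglongrightarrow> gradient_flow (\<lambda>y. ereal_integral \<mu> (\<lambda>e. f e y)) t x)"
proof -
  interpret P: prob_space P by fact
  interpret \<mu>: prob_space \<mu> by fact
  obtain L :: "'e \<Rightarrow> real" where L: "L2_map \<mu> L" "\<And>e. e \<in> space \<mu> \<Longrightarrow> 0 < L e"
    "\<And>e x y. e \<in> space \<mu> \<Longrightarrow> \<bar>f e x - f e y\<bar> \<le> ereal (L e * dist x y)"
    using assms(10) unfolding L2_Lipschitz_def by blast
  define g where "g e x = real_of_ereal (f e x)" for e x
  have f_g: "f e x = ereal (g e x)" if "e \<in> space \<mu>" for e x
    unfolding g_def using assms(9) L(3) that unfolding proper_integrand_def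
    by (intro proper_lipschitz_finite) auto
  have [measurable]: "L \<in> borel_measurable \<mu>"
    using L(1) by (simp add: L2_map_def)
  have L2: "integrable \<mu> (\<lambda>e. (L e)\<^sup>2)"
    using \<mu>.L2_map_integrable_dist[OF L(1), of 0] by (simp add: dist_real_def)
  have g_lip: "\<bar>g e x - g e y\<bar> \<le> L e * dist x y" if "e \<in> space \<mu>" for e x y
    using L(3)[OF that, of x y] f_g[OF that] by simp
  have g_meas: "(\<lambda>e. g e x) \<in> borel_measurable \<mu>" for x
    by (rule normal_integrand_measurable[OF _ f_g]) (use assms(8) in \<open>simp_all add: normal_convex_integrand_def\<close>)
  have g_cl: "convex_lipschitz (L e) (g e)" if e: "e \<in> space \<mu>" for e
  proof -
    have "f e = (\<lambda>x. ereal (g e x))"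
      using f_g[OF e] by blast
    then show ?thesis
      using assms(8) L(2)[OF e] e g_lip
      unfolding convex_lipschitz_def normal_convex_integrand_def by (metis less_imp_le)
  qed
  \<comment> \<open>The value at \<open>x\<close> is dominated by the integrable value at
    \<open>u\<^sub>0\<close> plus \<open>L\<close> times \<open>dist (u\<^sub>0 e) x\<close>, a
    product of two square-integrable functions.\<close>
  have g_int: "integrable \<mu> (\<lambda>e. g e x)" for x
  proof -
    obtain g\<^sub>0 where g0: "integrable \<mu> g\<^sub>0" "AE e in \<mu>. f e (u\<^sub>0 e) = ereal (g\<^sub>0 e)"
      using assms(12) unfolding L1_ereal_def by blast
    show ?thesis
    proof (rule Bochner_Integration.integrable_bound)
      show "integrable \<mu> (\<lambda>e. \<bar>g\<^sub>0 e\<bar> + ((L e)\<^sup>2 + (dist (u\<^sub>0 e) x)\<^sup>2))"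
        using g0(1) L2 \<mu>.L2_map_integrable_dist[OF assms(11)] by auto
      show "AE e in \<mu>. norm (g e x) \<le> norm (\<bar>g\<^sub>0 e\<bar> + ((L e)\<^sup>2 + (dist (u\<^sub>0 e) x)\<^sup>2))"
        using g0(2) AE_space
      proof eventually_elim
        case (elim e)
        have "g e (u\<^sub>0 e) = g\<^sub>0 e"
          using elim f_g by simp
        moreover have "\<bar>g e (u\<^sub>0 e) - g e x\<bar> \<le> L e * dist (u\<^sub>0 e) x"
          using g_lip elim by blast
        moreover have "L e * dist (u\<^sub>0 e) x \<le> (L e)\<^sup>2 + (dist (u\<^sub>0 e) x)\<^sup>2"
        proof -
          have "0 \<le> L e * dist (u\<^sub>0 e) x"
            using L(2)[OF elim(2)] by simp
          then show ?thesis
            using sum_squares_bound[of "L e" "dist (u\<^sub>0 e) x"] by linarith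
        qed
        ultimately show ?case
          by simp
      qed
    qed (rule g_meas)
  qed
  interpret random_convex_functions P \<mu> \<xi> g L
  proof
    show "hadamard_space TYPE('h)"
      using assms(5) by (simp add: full_hilbert_hadamard_space_def)
  qed (use assms(6,7) g_cl g_int L2 in auto)
  have F: "(\<lambda>y. ereal_integral \<mu> (\<lambda>e. f e y)) = (\<lambda>y. ereal (F y))"
    unfolding F_def using g_int f_g by (intro ext ereal_integral_eq_integral)
  let ?conv = "\<lambda>\<omega> t x. (\<lambda>n. (prox_product (\<lambda>i. f (\<xi> i \<omega>)) (t / (real n)\<^sup>2) n ^^ n) x)
    \<longlonglongrightarrow> gradient_flow (\<lambda>y. ereal_integral \<mu> (\<lambda>e. f e y)) t x"
  have ae: "AE \<omega> in P. \<forall>t\<ge>0. \<forall>x. ?conv \<omega> t x"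
    using AE_prox_product_tendsto_gradient_flow AE_space
  proof eventually_elim
    case (elim \<omega>)
    \<comment> \<open>\<open>f\<close> and \<open>g\<close> are known to agree on
      \<open>space \<mu>\<close> only; the samples with indices \<open>1..n\<close> lie
      there.\<close>
    have fold: "prox_product (\<lambda>i. f (\<xi> i \<omega>)) c n = prox_product (\<lambda>i y. ereal (g (\<xi> i \<omega>) y)) c n" for c n
      unfolding prox_product_def
    proof (rule ext, rule fold_cong[OF refl refl])
      fix i assume "i \<in> set [1..<Suc n]"
      then have "f (\<xi> i \<omega>) = (\<lambda>y. ereal (g (\<xi> i \<omega>) y))"
        using f_g \<xi>_space elim(2) by auto
      then show "prox c (f (\<xi> i \<omega>)) = prox c (\<lambda>y. ereal (g (\<xi> i \<omega>) y))"
        by simp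
    qed
    \<comment> \<open>The case \<open>t = 0\<close>: every step size is 0, also at
      \<open>n = 0\<close> where \<open>0 / 0 = 0\<close>, so each factor is the identity by the
      convention in \<open>prox\<close>.\<close>
    have fold0: "fold (\<lambda>i. prox 0 (h i)) xs = id" for h :: "nat \<Rightarrow> 'h \<Rightarrow> ereal" and xs
      by (induction xs) (auto simp: prox_def fun_eq_iff)
    have prod0: "prox_product h (0 / (real n)\<^sup>2) n = id" for h :: "nat \<Rightarrow> 'h \<Rightarrow> ereal" and n
      unfolding prox_product_def div_0 by (rule fold0)
    show ?case
    proof (intro allI impI)
      fix t :: real and x :: 'h assume t: "0 \<le> t"
      show "?conv \<omega> t x"
      proof (cases "t = 0")
        case True
        show ?thesis
          unfolding True prod0 by (simp add: gradient_flow_def)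
      next
        case False
        then show ?thesis
          using elim(1) t unfolding fold F by (simp only: less_le not_sym simp_thms)
      qed
    qed
  qed
  \<comment> \<open>The complement of this null set is the measurable set that serves all
    \<open>t\<close> and \<open>x\<close> at once.\<close>
  obtain N where N: "\<And>\<omega>. \<omega> \<in> space P - N \<Longrightarrow> \<forall>t\<ge>0. \<forall>x. ?conv \<omega> t x" "N \<in> null_sets P"
    using AE_E3[OF ae] by blast
  have "measure P (space P - N) = 1"
    using N(2) by (simp add: P.prob_compl null_setsD2 measure_eq_0_null_sets)
  moreover have "space P - N \<in> sets P"
    using N(2) by auto
  moreover have "AE \<omega> in P. ?conv \<omega> t x" if "0 \<le> t" for t x
    using ae by (rule AE_mp) (use that in \<open>auto intro: AE_I2\<close>)
  ultimately show ?thesis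
    using N(1) by blast
qed

end
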